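(* Let $\triangle(q)=\sum_{n=0}^\infty q^{n(n+1)/2}$. For every integer $m\ge 1$ we have the identity of power series \[ q^{\frac{m^2}{2}}\,\triangle(q)^{4m^2}=\frac{2^m(2m)!}{\prod_{j=1}^m(2j)!^2}\sum_{\substack{x_j,y_j\in \frac12+\mathbb{Z}_{\ge 0}\\ 1\le j\le m}} f(\vec{\bm x})\,q^{2\sum_{j=1}^m x_jy_j}, \] where \[ f(\vec{\bm x})=\prod_{j=1}^m (x_j+y_j)\cdot\prod_{1\le i<j\le m}\Big((x_i-y_i)^2-(x_j-y_j)^2\Big)\Big((x_i+y_i)^2-(x_j+y_j)^2\Big). \]
   Context: Here $\vec{\bm x}$ denotes the tuple $(x_1,\dots,x_m,y_1,\dots,y_m)$ of summation variables; the sum runs over all $x_1,\dots,x_m,y_1,\dots,y_m\in\{1/2,3/2,5/2,\dots\}$. *)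

theory Defs
  imports
    "HOL-Computational_Algebra.Formal_Power_Series"
    "HOL-Library.FuncSet"
    "HOL-Analysis.Infinite_Sum"
begin

text \<open>
  Exponents of \<open>q\<close> are half-integers, so all series live in the ring of formal power series in
  \<open>t = q\<^sup>1\<^sup>/\<^sup>2\<close>, i.e. \<open>fps_X\<close> plays the role of \<open>t\<close>.  The monomial \<open>q\<^sup>r\<close> is \<open>t\<^sup>2\<^sup>r\<close>; this is
  meaningful for those \<open>r \<ge> 0\<close> with \<open>2 r\<close> an integer, and only such \<open>r\<close> are used.
  Infinite sums are taken in the \<open>t\<close>-adic topology of the type of formal power series.
\<close>

definition qpow :: "real \<Rightarrow> real fps" where
  "qpow r = fps_X ^ nat \<lfloor>2 * r\<rfloor>"

lemma qpow_half_of_nat: "qpow (real n / 2) = fps_X ^ n"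
  by (simp add: qpow_def)

lemma qpow_of_nat: "qpow (real n) = qpow 1 ^ n"
proof -
  have "\<lfloor>2 * real n\<rfloor> = int (2 * n)"
    by (metis floor_of_nat of_nat_mult of_nat_numeral)
  then show ?thesis by (simp add: qpow_def flip: power_mult)
qed

definition triangle_series :: "real fps \<Rightarrow> real fps" where
  "triangle_series q = (\<Sum>n. q ^ (n * (n + 1) div 2))"

definition half_odds :: "real set" where
  "half_odds = {1/2 + real n | n. True}"

text \<open>
  The tuples \<open>(x\<^sub>1, \<dots>, x\<^sub>m)\<close> with entries in \<open>half_odds\<close> are the extensional functions
  on \<open>{1..m}\<close>, so that each tuple is represented exactly once.
\<close>

definition half_odd_tuples :: "nat \<Rightarrow> (nat \<Rightarrow> real) set" where
  "half_odd_tuples m = ({1..m} \<rightarrow>\<^sub>E half_odds)"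

definition f_weight :: "nat \<Rightarrow> (nat \<Rightarrow> real) \<Rightarrow> (nat \<Rightarrow> real) \<Rightarrow> real" where
  "f_weight m x y = (\<Prod>j=1..m. x j + y j) *
     (\<Prod>i=1..m. \<Prod>j=i+1..m.
        ((x i - y i)\<^sup>2 - (x j - y j)\<^sup>2) * ((x i + y i)\<^sup>2 - (x j + y j)\<^sup>2))"

lemma half_odd_exponent:
  assumes "x \<in> half_odd_tuples m" "y \<in> half_odd_tuples m"
  shows "\<exists>n. 2 * (\<Sum>j=1..m. x j * y j) = real n / 2"
proof -
  have "\<exists>n. 4 * (x j * y j) = real n" if "j \<in> {1..m}" for j
  proof -
    have "x j \<in> half_odds" "y j \<in> half_odds"
      using assms that by (auto simp: half_odd_tuples_def)
    then obtain a b where "x j = 1/2 + real a" "y j = 1/2 + real b"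
      by (auto simp: half_odds_def)
    then have "4 * (x j * y j) = real ((1 + 2 * a) * (1 + 2 * b))"
      by (simp add: algebra_simps)
    then show ?thesis ..
  qed
  then obtain h where h: "\<And>j. j \<in> {1..m} \<Longrightarrow> 4 * (x j * y j) = real (h j)"
    by metis
  have "4 * (\<Sum>j=1..m. x j * y j) = (\<Sum>j=1..m. real (h j))"
    unfolding sum_distrib_left using h by (intro sum.cong) auto
  then have "2 * (\<Sum>j=1..m. x j * y j) = real (\<Sum>j=1..m. h j) / 2"
    by simp
  then show ?thesis ..
qed

end

theory Submission
  imports
    Defs
    "HOL-Computational_Algebra.Formal_Laurent_Series"
    "Jordan_Normal_Form.Determinant"
begin

text \<open>
  Write \<open>t = q\<^sup>1\<^sup>/\<^sup>2\<close>, \<open>n = x - y\<close>, \<open>N = x + y\<close>.  By Vandermonde and Andreief the sum is \<open>m!\<close> times the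
  determinant of the moments \<open>\<Sum> n\<^sup>2\<^sup>i N\<^sup>2\<^sup>j\<^sup>+\<^sup>1 t\<^sup>4\<^sup>x\<^sup>y\<close>, which are the Taylor coefficients of
  \<open>F(u, v) = \<Sum> cosh(n u) sinh(N v) t\<^sup>4\<^sup>x\<^sup>y\<close>.  Let \<open>A(u)\<close> and \<open>B(u)\<close> be the sums of
  \<open>t^(r\<^sup>2) exp(r u)\<close> over the even and the odd integers \<open>r\<close>.  A sign-reversing involution shows that
  \<open>F(u, v) (A(u) A(v) - B(u) B(v))\<close> does not depend on \<open>u\<close>.  After a linear change of \<open>A\<close> and \<open>B\<close>
  this reads \<open>F(u, v) = P(u) R(v) / (1 - S(u) S(v))\<close> with \<open>S = s u\<^sup>2 + \<dots>\<close>, \<open>P = 1 + \<dots>\<close> and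
  \<open>R = s v + \<dots>\<close>; expanding the geometric series is an LU decomposition of the moment matrix, so its
  determinant is \<open>s^(m\<^sup>2)\<close>, where \<open>s = \<Sum> (x + y) t\<^sup>4\<^sup>x\<^sup>y\<close>.

  It remains to see \<open>s = t \<triangle>(t\<^sup>2)\<^sup>4\<close>.  The same identity expresses \<open>s\<close> through the Wronskian of the
  theta constants \<open>A(0)\<close> and \<open>B(0)\<close>, which obey the recursion of the arithmetic-geometric mean under
  \<open>t \<mapsto> t\<^sup>2\<close>.  Hence \<open>s\<close> and \<open>t \<triangle>(t\<^sup>2)\<^sup>4\<close> are multiplied by the same factor under \<open>t \<mapsto> t\<^sup>2\<close>, so
  their quotient is constant.
\<close>

no_notation vec_index (infixl "$" 100)

section \<open>Sums of monomials indexed by a set\<close>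

definition nonneg_finite_fibres :: "'i set \<Rightarrow> ('i \<Rightarrow> int) \<Rightarrow> bool" where
  "nonneg_finite_fibres I e \<longleftrightarrow> (\<forall>i\<in>I. 0 \<le> e i) \<and> (\<forall>n. finite {i\<in>I. e i \<le> n})"

text \<open>
  \<open>qsum I e w\<close> is the series \<open>\<Sum>i\<in>I. w i t^(e i)\<close>; it is meaningful only if \<open>e\<close> is nonnegative with
  finite fibres on \<open>I\<close>, since otherwise terms are dropped.
\<close>

definition qsum :: "'i set \<Rightarrow> ('i \<Rightarrow> int) \<Rightarrow> ('i \<Rightarrow> real) \<Rightarrow> real fps" where
  "qsum I e w = Abs_fps (\<lambda>n. \<Sum>i\<in>{i\<in>I. e i = int n}. w i)"

lemma qsum_nth: "qsum I e w $ n = (\<Sum>i\<in>{i\<in>I. e i = int n}. w i)"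
  by (simp add: qsum_def)

lemma fibre_finite: "nonneg_finite_fibres I e \<Longrightarrow> finite {i\<in>I. e i = n}"
  unfolding nonneg_finite_fibres_def by (rule finite_subset[of _ "{i\<in>I. e i \<le> n}"]) auto

lemma fibre_finite_le: "nonneg_finite_fibres I e \<Longrightarrow> finite {i\<in>I. e i \<le> n}"
  unfolding nonneg_finite_fibres_def by auto

lemma fibre_nonneg: "nonneg_finite_fibres I e \<Longrightarrow> i \<in> I \<Longrightarrow> 0 \<le> e i"
  unfolding nonneg_finite_fibres_def by auto

lemma nonneg_finite_fibres_subset:
  "nonneg_finite_fibres I e \<Longrightarrow> J \<subseteq> I \<Longrightarrow> nonneg_finite_fibres J e"
  unfolding nonneg_finite_fibres_def by (auto intro: finite_subset[rotated])

lemma nonneg_finite_fibresI: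
  assumes "\<And>i. i \<in> I \<Longrightarrow> 0 \<le> e i"
    and "\<And>n. finite (S n)" and "\<And>i. i \<in> I \<Longrightarrow> i \<in> S (e i)" and "mono S"
  shows "nonneg_finite_fibres I e"
  unfolding nonneg_finite_fibres_def
proof (intro conjI allI ballI)
  fix n show "finite {i\<in>I. e i \<le> n}"
    by (rule finite_subset[OF _ assms(2)[of n]]) (use assms(3,4) in \<open>auto dest: monoD\<close>)
qed (use assms in auto)

lemma nonneg_finite_fibres_times:
  assumes "nonneg_finite_fibres I e" "nonneg_finite_fibres J e'"
  shows "nonneg_finite_fibres (I \<times> J) (\<lambda>(i, j). e i + e' j)"
  unfolding nonneg_finite_fibres_def
proof (intro conjI allI ballI)
  fix n
  have "{p \<in> I \<times> J. (case p of (i, j) \<Rightarrow> e i + e' j) \<le> n}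
      \<subseteq> {i\<in>I. e i \<le> n} \<times> {j\<in>J. e' j \<le> n}"
    using fibre_nonneg[OF assms(1)] fibre_nonneg[OF assms(2)] by fastforce
  then show "finite {p \<in> I \<times> J. (case p of (i, j) \<Rightarrow> e i + e' j) \<le> n}"
    by (rule finite_subset) (use assms in \<open>auto intro: fibre_finite_le\<close>)
qed (use fibre_nonneg[OF assms(1)] fibre_nonneg[OF assms(2)] in fastforce)

lemma qsum_cong:
  assumes "\<And>i. i \<in> I \<Longrightarrow> e i = e' i" "\<And>i. i \<in> I \<Longrightarrow> w i = w' i"
  shows "qsum I e w = qsum I e' w'"
  unfolding qsum_def by (intro arg_cong[where f = Abs_fps] ext sum.cong) (use assms in auto)

lemma qsum_reindex:
  assumes "bij_betw f I J"
    and "\<And>i. i \<in> I \<Longrightarrow> e' (f i) = e i" "\<And>i. i \<in> I \<Longrightarrow> w' (f i) = w i"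
  shows "qsum I e w = qsum J e' w'"
proof (rule fps_ext)
  fix n
  have "bij_betw f {i\<in>I. e i = int n} {j\<in>J. e' j = int n}"
    using assms(1,2) by (auto simp: bij_betw_def inj_on_def)
  then show "qsum I e w $ n = qsum J e' w' $ n"
    unfolding qsum_nth using sum.reindex_bij_betw[of f _ _ w'] assms(3)
    by (metis (no_types, lifting) mem_Collect_eq sum.cong)
qed

text \<open>Reindexing along \<open>f\<close> turns the series into its negative. Fixed points of
  \<open>f\<close> do no harm, since there the weight is its own negative.\<close>

lemma qsum_involution_eq_0:
  assumes "\<And>i. i \<in> I \<Longrightarrow> f i \<in> I" "\<And>i. i \<in> I \<Longrightarrow> f (f i) = i"
    and "\<And>i. i \<in> I \<Longrightarrow> e (f i) = e i" "\<And>i. i \<in> I \<Longrightarrow> w (f i) = - w i"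
  shows "qsum I e w = 0"
proof -
  have bij: "bij_betw f I I"
    by (rule bij_betw_byWitness[where f' = f]) (use assms in auto)
  have "qsum I e w = qsum I e (\<lambda>i. - w i)"
    by (rule qsum_reindex[OF bij]) (use assms in auto)
  also have "\<dots> = - qsum I e w"
    by (simp add: fps_eq_iff qsum_nth sum_negf)
  finally show ?thesis by (simp add: fps_eq_iff)
qed

lemma qsum_union:
  assumes "nonneg_finite_fibres (I \<union> J) e" "I \<inter> J = {}"
  shows "qsum (I \<union> J) e w = qsum I e w + qsum J e w"
proof (rule fps_ext)
  fix n
  have "{i \<in> I \<union> J. e i = int n} = {i\<in>I. e i = int n} \<union> {i\<in>J. e i = int n}" by auto
  then show "qsum (I \<union> J) e w $ n = (qsum I e w + qsum J e w) $ n"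
    using fibre_finite[OF assms(1), of n] assms(2)
    by (auto simp: qsum_nth intro!: sum.union_disjoint)
qed

lemma qsum_nonzero_weights:
  assumes "nonneg_finite_fibres I e" "J \<subseteq> I" "\<And>i. i \<in> I - J \<Longrightarrow> w i = 0"
  shows "qsum I e w = qsum J e w"
  by (rule fps_ext, unfold qsum_nth, rule sum.mono_neutral_right)
    (use assms fibre_finite[OF assms(1)] in auto)

lemma qsum_0 [simp]: "qsum I e (\<lambda>_. 0) = 0"
  by (simp add: fps_eq_iff qsum_nth)

lemma qsum_add: "qsum I e (\<lambda>i. w i + w' i) = qsum I e w + qsum I e w'"
  by (simp add: fps_eq_iff qsum_nth sum.distrib)

lemma qsum_diff: "qsum I e (\<lambda>i. w i - w' i) = qsum I e w - qsum I e w'"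
  by (simp add: fps_eq_iff qsum_nth sum_subtractf)

lemma qsum_uminus: "qsum I e (\<lambda>i. - w i) = - qsum I e w"
  by (simp add: fps_eq_iff qsum_nth sum_negf)

lemma qsum_cmult: "qsum I e (\<lambda>i. c * w i) = fps_const c * qsum I e w"
  by (simp add: fps_eq_iff qsum_nth sum_distrib_left)

lemma qsum_sum: "qsum I e (\<lambda>i. \<Sum>k\<in>K. w k i) = (\<Sum>k\<in>K. qsum I e (w k))"
  by (simp add: fps_eq_iff qsum_nth fps_sum_nth sum.swap[of _ K])

lemma qsum_mult:
  assumes "nonneg_finite_fibres I e" "nonneg_finite_fibres J e'"
  shows "qsum I e w * qsum J e' w' =
    qsum (I \<times> J) (\<lambda>(i, j). e i + e' j) (\<lambda>(i, j). w i * w' j)"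
proof (rule fps_ext)
  fix n
  let ?I = "\<lambda>k. {i\<in>I. e i = int k}" and ?J = "\<lambda>k. {i\<in>J. e' i = int k}"
  have *: "{p \<in> I \<times> J. (case p of (i, j) \<Rightarrow> e i + e' j) = int n}
      = (\<Union>k\<in>{0..n}. ?I k \<times> ?J (n - k))" (is "?L = ?R")
  proof (intro equalityI subsetI)
    fix p assume "p \<in> ?L"
    then obtain i j where p: "p = (i, j)" "i \<in> I" "j \<in> J" "e i + e' j = int n" by auto
    with fibre_nonneg[OF assms(1)] fibre_nonneg[OF assms(2)]
    have "0 \<le> e i" "0 \<le> e' j" by auto
    with p show "p \<in> ?R" by (intro UN_I[of "nat (e i)"]) auto
  qed (auto)
  have "(qsum I e w * qsum J e' w') $ n
      = (\<Sum>k=0..n. \<Sum>(i, j)\<in>?I k \<times> ?J (n - k). w i * w' j)"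
    by (simp add: fps_mult_nth qsum_nth sum_product sum.cartesian_product)
  also have "\<dots> = (\<Sum>(i, j)\<in>(\<Union>k\<in>{0..n}. ?I k \<times> ?J (n - k)). w i * w' j)"
    by (rule sum.UNION_disjoint[symmetric])
      (auto intro: fibre_finite[OF assms(1)] fibre_finite[OF assms(2)])
  finally show "(qsum I e w * qsum J e' w') $ n =
      qsum (I \<times> J) (\<lambda>(i, j). e i + e' j) (\<lambda>(i, j). w i * w' j) $ n"
    by (simp add: qsum_nth *)
qed

lemma qsum_fibres:
  assumes "nonneg_finite_fibres I e" "\<And>i. i \<in> I \<Longrightarrow> f i \<in> J" "\<And>i. i \<in> I \<Longrightarrow> e i = e' (f i)"
    and "nonneg_finite_fibres J e'"
  shows "qsum I e w = qsum J e' (\<lambda>j. \<Sum>i\<in>{i\<in>I. f i = j}. w i)"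
proof (rule fps_ext)
  fix n
  have "qsum I e w $ n = (\<Sum>j\<in>{j\<in>J. e' j = int n}. \<Sum>i\<in>{i\<in>{i\<in>I. e i = int n}. f i = j}. w i)"
    unfolding qsum_nth
    by (rule sum.group[symmetric])
      (use assms fibre_finite[OF assms(1)] fibre_finite[OF assms(4)] in auto)
  also have "\<dots> = qsum J e' (\<lambda>j. \<Sum>i\<in>{i\<in>I. f i = j}. w i) $ n"
    unfolding qsum_nth by (intro sum.cong refl) (use assms(3) in auto)
  finally show "qsum I e w $ n = \<dots>" .
qed

lemma fps_X_power_mult_qsum:
  assumes "nonneg_finite_fibres I e"
  shows "fps_X ^ c * qsum I e w = qsum I (\<lambda>i. int c + e i) w"
proof (rule fps_ext)
  fix n
  show "(fps_X ^ c * qsum I e w) $ n = qsum I (\<lambda>i. int c + e i) w $ n"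
  proof (cases "n < c")
    case True
    then have "{i\<in>I. int c + e i = int n} = {}"
      using fibre_nonneg[OF assms] by force
    with True show ?thesis by (simp only: fps_X_power_mult_nth qsum_nth if_True sum.empty)
  next
    case False
    then have "{i\<in>I. int c + e i = int n} = {i\<in>I. e i = int (n - c)}" by auto
    with False show ?thesis by (simp add: fps_X_power_mult_nth qsum_nth)
  qed
qed

lemma fps_X_mult_deriv_qsum:
  "fps_X * fps_deriv (qsum I e w) = qsum I e (\<lambda>i. of_int (e i) * w i)"
proof (rule fps_ext)
  fix n
  show "(fps_X * fps_deriv (qsum I e w)) $ n = qsum I e (\<lambda>i. of_int (e i) * w i) $ n"
    by (cases n) (auto simp: qsum_nth sum_distrib_left intro!: sum.cong)
qed

lemma qsum_dilate:
  "qsum I (\<lambda>i. 2 * e i) w = qsum I e w oo fps_X\<^sup>2"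
proof (rule fps_ext)
  fix n
  have "(qsum I e w oo fps_X\<^sup>2) $ n = (if even n then qsum I e w $ (n div 2) else 0)"
    by (simp add: fps_nth_compose_X_power)
  moreover have "{i\<in>I. 2 * e i = int n} = (if even n then {i\<in>I. e i = int (n div 2)} else {})"
    by (auto elim!: evenE) presburger+
  ultimately show "qsum I (\<lambda>i. 2 * e i) w $ n = (qsum I e w oo fps_X\<^sup>2) $ n"
    by (simp add: qsum_nth)
qed

text \<open>The bridge to infinite sums: the coefficient at \<open>n\<close> of a partial sum is
  final as soon as the finite index set contains the fibre of exponent \<open>n\<close>.\<close>

lemma has_sum_qsum:
  assumes "nonneg_finite_fibres I e"
  shows "((\<lambda>i. fps_const (w i) * fps_X ^ nat (e i)) has_sum qsum I e w) I"
  unfolding has_sum_def tendsto_fps_iff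
proof
  fix n
  show "\<forall>\<^sub>F F in finite_subsets_at_top I.
      (\<Sum>i\<in>F. fps_const (w i) * fps_X ^ nat (e i)) $ n = qsum I e w $ n"
    unfolding eventually_finite_subsets_at_top
  proof (intro exI[of _ "{i\<in>I. e i = int n}"] conjI allI impI)
    show "finite {i\<in>I. e i = int n}" by (rule fibre_finite[OF assms])
    fix F assume F: "finite F \<and> {i\<in>I. e i = int n} \<subseteq> F \<and> F \<subseteq> I"
    have "(\<Sum>i\<in>F. fps_const (w i) * fps_X ^ nat (e i)) $ n
        = (\<Sum>i\<in>F. if e i = int n then w i else 0)"
      unfolding fps_sum_nth
      by (intro sum.cong refl) (use fibre_nonneg[OF assms] F in \<open>auto simp: fps_X_power_iff\<close>)
    also have "\<dots> = qsum I e w $ n"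
      unfolding qsum_nth by (rule sum.mono_neutral_cong_right) (use F in auto)
    finally show "(\<Sum>i\<in>F. fps_const (w i) * fps_X ^ nat (e i)) $ n = qsum I e w $ n" .
  qed auto
qed

lemma nonneg_finite_fibres_PiE:
  assumes "finite A" "nonneg_finite_fibres I e"
  shows "nonneg_finite_fibres (A \<rightarrow>\<^sub>E I) (\<lambda>z. \<Sum>a\<in>A. e (z a))"
  unfolding nonneg_finite_fibres_def
proof (intro conjI allI ballI)
  fix n
  have "z a \<in> {i\<in>I. e i \<le> n}" if "z \<in> A \<rightarrow>\<^sub>E I" "(\<Sum>a\<in>A. e (z a)) \<le> n" "a \<in> A" for z a
  proof -
    have "e (z a) \<le> (\<Sum>a\<in>A. e (z a))"
      by (rule member_le_sum) (use that assms fibre_nonneg[OF assms(2)] in auto)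
    with that show ?thesis by auto
  qed
  then have "{z \<in> A \<rightarrow>\<^sub>E I. (\<Sum>a\<in>A. e (z a)) \<le> n} \<subseteq> A \<rightarrow>\<^sub>E {i\<in>I. e i \<le> n}"
    by (fastforce simp: PiE_def Pi_def)
  then show "finite {z \<in> A \<rightarrow>\<^sub>E I. (\<Sum>a\<in>A. e (z a)) \<le> n}"
    by (rule finite_subset) (intro finite_PiE assms fibre_finite_le)
qed (use fibre_nonneg[OF assms(2)] in \<open>auto intro!: sum_nonneg\<close>)

lemma prod_qsum:
  assumes "finite A" "nonneg_finite_fibres I e"
  shows "(\<Prod>a\<in>A. qsum I e (w a)) =
    qsum (A \<rightarrow>\<^sub>E I) (\<lambda>z. \<Sum>a\<in>A. e (z a)) (\<lambda>z. \<Prod>a\<in>A. w a (z a))"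
  using assms(1)
proof induction
  case empty
  show ?case by (auto simp: fps_eq_iff qsum_nth)
next
  case (insert b A)
  let ?f = "\<lambda>(i, z). z(b := i)"
  have bij: "bij_betw ?f (I \<times> (A \<rightarrow>\<^sub>E I)) (insert b A \<rightarrow>\<^sub>E I)"
    using inj_combinator[of b A "\<lambda>_. I"] insert.hyps
    by (auto simp: bij_betw_def PiE_insert_eq)
  have "(\<Prod>a\<in>insert b A. qsum I e (w a)) = qsum I e (w b) * 
      qsum (A \<rightarrow>\<^sub>E I) (\<lambda>z. \<Sum>a\<in>A. e (z a)) (\<lambda>z. \<Prod>a\<in>A. w a (z a))"
    using insert by simp
  also have "\<dots> = qsum (I \<times> (A \<rightarrow>\<^sub>E I)) (\<lambda>(i, z). e i + (\<Sum>a\<in>A. e (z a)))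
      (\<lambda>(i, z). w b i * (\<Prod>a\<in>A. w a (z a)))"
    by (rule qsum_mult) (use assms(2) insert.hyps in \<open>auto intro: nonneg_finite_fibres_PiE\<close>)
  also have "\<dots> = qsum (insert b A \<rightarrow>\<^sub>E I) (\<lambda>z. \<Sum>a\<in>insert b A. e (z a))
      (\<lambda>z. \<Prod>a\<in>insert b A. w a (z a))"
    by (rule qsum_reindex[OF bij]) (use insert.hyps in \<open>auto intro!: sum.cong prod.cong\<close>)
  finally show ?case .
qed

section \<open>Theta constants\<close>

text \<open>Jacobi's theta_3(0) at nome t^c; \<open>theta_half c\<close> is theta_2(0) at the same
  nome with the factor t^(c/4) removed, so that exponents stay integral.\<close>

definition theta_even :: "int \<Rightarrow> real fps" where
  "theta_even c = qsum UNIV (\<lambda>k. c * k\<^sup>2) (\<lambda>_. 1)"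

definition theta_half :: "int \<Rightarrow> real fps" where
  "theta_half c = qsum UNIV (\<lambda>k. c * (k\<^sup>2 + k)) (\<lambda>_. 1)"

lemma abs_le_square_int: "\<bar>k\<bar> \<le> (k::int)\<^sup>2"
proof (cases "k = 0")
  case False
  then have "\<bar>k\<bar> * 1 \<le> \<bar>k\<bar> * \<bar>k\<bar>" by (intro mult_left_mono) auto
  then show ?thesis by (simp add: power2_eq_square)
qed simp

lemma abs_le_square_add_int: "\<bar>k\<bar> - 1 \<le> (k::int)\<^sup>2 + k"
proof (cases "k \<ge> 0")
  case False
  then have "0 \<le> (k + 1) * (k + 1)" by simp
  with False show ?thesis by (simp add: power2_eq_square algebra_simps)
next
  case True then show ?thesis using zero_le_power2[of k] by linarith
qed

lemma square_add_nonneg_int: "0 \<le> (k::int)\<^sup>2 + k"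
  using abs_le_square_add_int[of k] by (cases "k = 0") auto

lemma nonneg_finite_fibres_square:
  assumes "c > 0" shows "nonneg_finite_fibres UNIV (\<lambda>k::int. c * k\<^sup>2)"
proof (rule nonneg_finite_fibresI[where S = "\<lambda>n. {-n..n}"])
  fix k :: int
  have "1 * k\<^sup>2 \<le> c * k\<^sup>2" using assms by (intro mult_right_mono) auto
  then show "k \<in> {- (c * k\<^sup>2)..c * k\<^sup>2}" using abs_le_square_int[of k] by auto
qed (use assms in \<open>auto intro!: monoI\<close>)

lemma nonneg_finite_fibres_square_add:
  assumes "c > 0" shows "nonneg_finite_fibres UNIV (\<lambda>k::int. c * (k\<^sup>2 + k))"
proof (rule nonneg_finite_fibresI[where S = "\<lambda>n. {-n - 1..n + 1}"])
  fix k :: int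
  show "0 \<le> c * (k\<^sup>2 + k)" using square_add_nonneg_int[of k] assms by simp
  have "1 * (k\<^sup>2 + k) \<le> c * (k\<^sup>2 + k)"
    using assms square_add_nonneg_int[of k] by (intro mult_right_mono) auto
  then show "k \<in> {- (c * (k\<^sup>2 + k)) - 1..c * (k\<^sup>2 + k) + 1}"
    using abs_le_square_add_int[of k] by auto
qed (auto intro!: monoI)

text \<open>This rotation onto a sublattice of index 2 turns m^2 + n^2 into 2 r^2 + 2 s^2, which is
  the source of every doubling of the nome.\<close>

lemma bij_sum_diff_even:
  "bij_betw (\<lambda>(r, s). (r + s, r - s)) UNIV {(m, n :: int). even (m + n)}"
  by (rule bij_betw_byWitness[where f' = "\<lambda>(m, n). ((m + n) div 2, (m - n) div 2)"])
    (auto elim!: evenE; presburger)+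

text \<open>theta_2(q)^2 = 2 theta_2(q^2) theta_3(q^2). The reflection l -> -1 - l keeps l^2 + l and
  changes parity, so pairs of odd sum contribute as much as pairs of even sum; the latter separate
  after rotation.\<close>

lemma theta_half_square:
  assumes "c > 0"
  shows "theta_half c * theta_half c = 2 * theta_half (2 * c) * theta_even (2 * c)"
proof -
  define e where "e = (\<lambda>(k, l :: int). c * (k\<^sup>2 + k) + c * (l\<^sup>2 + l))"
  let ?E = "{(k, l :: int). even (k + l)}" and ?O = "{(k, l :: int). odd (k + l)}"
  have fin: "nonneg_finite_fibres UNIV e"
    unfolding e_def using nonneg_finite_fibres_times[OF nonneg_finite_fibres_square_add[OF assms]
        nonneg_finite_fibres_square_add[OF assms]] by simp
  have "theta_half c * theta_half c = qsum UNIV e (\<lambda>_. 1)"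
    unfolding theta_half_def e_def
    by (subst qsum_mult) (auto intro!: nonneg_finite_fibres_square_add assms qsum_cong)
  also have "(UNIV :: (int \<times> int) set) = ?E \<union> ?O" by auto
  also have "qsum (?E \<union> ?O) e (\<lambda>_. 1) = qsum ?E e (\<lambda>_. 1) + qsum ?O e (\<lambda>_. 1)"
    by (rule qsum_union) (auto intro: nonneg_finite_fibres_subset[OF fin])
  also have "qsum ?O e (\<lambda>_. 1) = qsum ?E e (\<lambda>_. 1)"
  proof (rule qsum_reindex[where f = "\<lambda>(k, l). (k, - 1 - l)"])
    show "bij_betw (\<lambda>(k, l). (k, - 1 - l)) ?O ?E"
      by (rule bij_betw_byWitness[where f' = "\<lambda>(k, l). (k, - 1 - l)"]) auto
  qed (auto simp: e_def power2_eq_square algebra_simps)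
  also have "qsum ?E e (\<lambda>_. 1) =
      qsum UNIV (\<lambda>(r, s). 2 * c * (r\<^sup>2 + r) + 2 * c * s\<^sup>2) (\<lambda>_. 1)"
    by (rule qsum_reindex[symmetric, OF bij_sum_diff_even])
      (auto simp: e_def power2_eq_square algebra_simps)
  also have "\<dots> = theta_half (2 * c) * theta_even (2 * c)"
    unfolding theta_half_def theta_even_def using assms
    by (subst qsum_mult)
      (auto intro!: nonneg_finite_fibres_square nonneg_finite_fibres_square_add qsum_cong)
  finally show ?thesis by simp
qed

lemma bij_odd_int: "bij_betw (\<lambda>k. 2 * k + 1) UNIV {k :: int. odd k}"
  by (rule bij_betw_byWitness[where f' = "\<lambda>k. k div 2"]) auto

lemma bij_even_int: "bij_betw (\<lambda>k. 2 * k) UNIV {k :: int. even k}"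
  by (rule bij_betw_byWitness[where f' = "\<lambda>k. k div 2"]) auto

text \<open>theta_3(q)^2 = theta_3(q^2)^2 + theta_2(q^2)^2 at q = t^(2c): after rotation the
  coordinates are both even or both odd, and each class is a square. The power
  \<open>fps_X ^ c\<close> restores the factor missing from \<open>theta_half\<close>.\<close>

lemma theta_even_square:
  assumes "c > 0"
  shows "theta_even (2 * int c) * theta_even (2 * int c) =
    theta_even (4 * int c) * theta_even (4 * int c) +
    (fps_X ^ c * theta_half (4 * int c)) * (fps_X ^ c * theta_half (4 * int c))"
proof -
  define e where "e = (\<lambda>(m, n :: int). int c * m\<^sup>2 + int c * n\<^sup>2)"
  let ?ev = "{k :: int. even k}" and ?od = "{k :: int. odd k}"
  have sq: "nonneg_finite_fibres I (\<lambda>k. int c * k\<^sup>2)" for I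
    using nonneg_finite_fibres_subset[OF nonneg_finite_fibres_square[of "int c"]] assms by auto
  have fin: "nonneg_finite_fibres I e" for I
    unfolding e_def
    by (rule nonneg_finite_fibres_subset[OF nonneg_finite_fibres_times[OF sq sq], of _ UNIV UNIV]) auto
  have times: "qsum (I \<times> I) e (\<lambda>_. 1) =
     qsum I (\<lambda>k. int c * k\<^sup>2) (\<lambda>_. 1) * qsum I (\<lambda>k. int c * k\<^sup>2) (\<lambda>_. 1)" for I
    unfolding e_def by (subst qsum_mult[OF sq sq]) (auto intro!: qsum_cong)
  have "theta_even (2 * int c) * theta_even (2 * int c) =
      qsum UNIV (\<lambda>(r, s). 2 * int c * r\<^sup>2 + 2 * int c * s\<^sup>2) (\<lambda>_. 1)"
    unfolding theta_even_def using assms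
    by (subst qsum_mult) (auto intro!: nonneg_finite_fibres_square qsum_cong)
  also have "\<dots> = qsum {(m, n). even (m + n)} e (\<lambda>_. 1)"
    by (rule qsum_reindex[OF bij_sum_diff_even])
      (auto simp: e_def power2_eq_square algebra_simps)
  also have "{(m, n). even (m + n)} = ?ev \<times> ?ev \<union> ?od \<times> ?od" by auto
  also have "qsum (?ev \<times> ?ev \<union> ?od \<times> ?od) e (\<lambda>_. 1) =
      qsum (?ev \<times> ?ev) e (\<lambda>_. 1) + qsum (?od \<times> ?od) e (\<lambda>_. 1)"
    by (rule qsum_union[OF fin]) auto
  also have "qsum (?ev \<times> ?ev) e (\<lambda>_. 1) =
      qsum ?ev (\<lambda>k. int c * k\<^sup>2) (\<lambda>_. 1) * qsum ?ev (\<lambda>k. int c * k\<^sup>2) (\<lambda>_. 1)"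
    by (rule times)
  also have "qsum (?od \<times> ?od) e (\<lambda>_. 1) =
      qsum ?od (\<lambda>k. int c * k\<^sup>2) (\<lambda>_. 1) * qsum ?od (\<lambda>k. int c * k\<^sup>2) (\<lambda>_. 1)"
    by (rule times)
  also have "qsum ?ev (\<lambda>k. int c * k\<^sup>2) (\<lambda>_. 1) = theta_even (4 * int c)"
    unfolding theta_even_def
    by (rule qsum_reindex[OF bij_even_int, symmetric]) (auto simp: power2_eq_square)
  also have "qsum ?od (\<lambda>k. int c * k\<^sup>2) (\<lambda>_. 1) = fps_X ^ c * theta_half (4 * int c)"
    unfolding theta_half_def using assms
    by (subst fps_X_power_mult_qsum[OF nonneg_finite_fibres_square_add], simp)
      (rule qsum_reindex[OF bij_odd_int, symmetric], auto simp: power2_eq_square algebra_simps)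
  finally show ?thesis .
qed

section \<open>The dilation t -> t^2 and series determined by it\<close>

lemma dilate_nth:
  fixes f :: "real fps"
  shows "(f oo fps_X\<^sup>2) $ n = (if even n then f $ (n div 2) else 0)"
  by (simp add: fps_nth_compose_X_power)

lemma fps_X_deriv_dilate:
  fixes f :: "real fps"
  shows "fps_X * fps_deriv (f oo fps_X\<^sup>2) = 2 * ((fps_X * fps_deriv f) oo fps_X\<^sup>2)"
proof (rule fps_ext)
  fix n
  have *: "(fps_X * fps_deriv g) $ k = of_nat k * g $ k" for g :: "real fps" and k
    by (cases k) auto
  show "(fps_X * fps_deriv (f oo fps_X\<^sup>2)) $ n = (2 * ((fps_X * fps_deriv f) oo fps_X\<^sup>2)) $ n"
    unfolding fps_numeral_fps_const fps_mult_left_const_nth dilate_nth *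
    by (auto elim!: evenE)
qed

text \<open>The relation says that r/z is invariant under t -> t^2. A nonzero difference d = r - z
  satisfies it too; comparing orders forces d to have order 1, while the agreeing coefficients force
  order at least 2.\<close>

lemma dilate_proportional_imp_eq:
  fixes r z :: "real fps"
  assumes rz: "r * (z oo fps_X\<^sup>2) = (r oo fps_X\<^sup>2) * z"
    and "r $ 0 = 0" "z $ 0 = 0" "r $ 1 = z $ 1" "z $ 1 \<noteq> 0"
  shows "r = z"
proof (rule ccontr)
  assume "r \<noteq> z"
  define d where "d = r - z"
  have "d \<noteq> 0" using \<open>r \<noteq> z\<close> by (simp add: d_def)
  have subdeg: "f oo fps_X\<^sup>2 \<noteq> 0 \<and> subdegree (f oo fps_X\<^sup>2) = 2 * subdegree f"
    if "f \<noteq> 0" for f :: "real fps"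
  proof -
    have "(f oo fps_X\<^sup>2) $ (2 * subdegree f) \<noteq> 0" using that by (simp add: dilate_nth)
    moreover have "(f oo fps_X\<^sup>2) $ k = 0" if "k < 2 * subdegree f" for k
      using that by (auto simp: dilate_nth intro!: nth_less_subdegree_zero)
    ultimately show ?thesis by (metis subdegreeI fps_zero_nth)
  qed
  have dprop: "d * (z oo fps_X\<^sup>2) = (d oo fps_X\<^sup>2) * z"
    using rz by (simp add: d_def algebra_simps fps_compose_sub_distrib)
  have z: "z \<noteq> 0" "subdegree z = 1"
    using assms by (auto intro!: subdegreeI)
  have "subdegree d + 2 = 2 * subdegree d + 1"
    using arg_cong[OF dprop, of subdegree] subdeg[OF z(1)] subdeg[OF \<open>d \<noteq> 0\<close>] z \<open>d \<noteq> 0\<close>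
    by simp
  moreover have "2 \<le> subdegree d"
  proof (rule subdegree_geI[OF \<open>d \<noteq> 0\<close>])
    fix i :: nat assume "i < 2"
    then have "i = 0 \<or> i = 1" by auto
    then show "d $ i = 0" using assms by (auto simp: d_def)
  qed
  ultimately show False by simp
qed

lemma theta_half_nth_0: "theta_half 1 $ 0 = 2"
proof -
  have "{k :: int. k\<^sup>2 + k = 0} = {0, -1}"
  proof -
    have "k\<^sup>2 + k = k * (k + 1)" for k :: int by (simp add: power2_eq_square algebra_simps)
    then show ?thesis by (auto simp: mult_eq_0_iff)
  qed
  then show ?thesis by (simp add: theta_half_def qsum_nth)
qed

text \<open>
  Both sides satisfy the same recursion under \<open>t \<mapsto> t\<^sup>2\<close>, which is the step of the
  arithmetic-geometric mean on the theta constants.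
\<close>

lemma wronskian_quotient_eq_theta_half_power4:
  fixes r :: "real fps"
  defines "al \<equiv> theta_even 4" and "be \<equiv> fps_X * theta_half 4"
  assumes W: "2 * r * (al * al - be * be) = al * (fps_X * fps_deriv be) - be * (fps_X * fps_deriv al)"
    and r: "r $ 0 = 0" "r $ 1 = 1"
  shows "16 * r = fps_X * theta_half 1 ^ 4"
proof -
  define dl :: "real fps \<Rightarrow> real fps" where "dl = (\<lambda>f. f oo fps_X\<^sup>2)"
  define th :: "real fps \<Rightarrow> real fps" where "th = (\<lambda>f. fps_X * fps_deriv f)"
  \<comment> \<open>\<open>al\<close> and \<open>be\<close> are theta_3 and theta_2 at nome t^4;
    \<open>a1\<close> and \<open>b1\<close> are their images under t -> t^2.\<close>
  define a1 where "a1 = theta_even 8"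
  define b1 where "b1 = fps_X\<^sup>2 * theta_half 8"
  \<comment> \<open>This is 1/16 of the right-hand side, expanded by the doubling formulas;
    \<open>zX\<close> checks it.\<close>
  define z where "z = fps_const (1/2) * (al * be * (al * al + be * be))"
  have dl_mult: "dl (f * g) = dl f * dl g" for f g
    unfolding dl_def by (rule fps_compose_mult_distrib) simp
  have dl_add: "dl (f + g) = dl f + dl g" and dl_diff: "dl (f - g) = dl f - dl g" for f g
    unfolding dl_def by (rule fps_compose_add_distrib fps_compose_sub_distrib)+
  have dl_two: "dl 2 = 2" unfolding dl_def by (simp add: fps_numeral_fps_const)
  have th_mult: "th (f * g) = th f * g + f * th g" for f g
    by (simp add: th_def algebra_simps)
  have th_add: "th (f + g) = th f + th g" for f g by (simp add: th_def algebra_simps)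
  have th_two: "th 2 = 0" by (simp add: th_def fps_numeral_fps_const)
  have th_dl: "th (dl f) = 2 * dl (th f)" for f
    unfolding th_def dl_def by (rule fps_X_deriv_dilate)
  have dl_al: "dl al = a1"
    unfolding dl_def al_def a1_def theta_even_def by (simp flip: qsum_dilate)
  have dl_be: "dl be = b1"
  proof -
    have "dl (theta_half 4) = theta_half 8"
      unfolding dl_def theta_half_def by (simp flip: qsum_dilate)
    moreover have "dl fps_X = fps_X\<^sup>2" by (simp add: dl_def)
    ultimately show ?thesis by (simp add: be_def b1_def dl_mult)
  qed
  have al2: "al * al = a1 * a1 + b1 * b1"
    using theta_even_square[of 2] by (simp add: al_def a1_def b1_def)
  have be2: "be * be = 2 * a1 * b1"
    using theta_half_square[of 4] by (simp add: be_def a1_def b1_def power2_eq_square mult_ac)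
  \<comment> \<open>Dilation of \<open>W\<close>; the extra factor 2 comes from
    \<open>th_dl\<close>.\<close>
  have W1: "4 * dl r * (a1 * a1 - b1 * b1) = a1 * th b1 - b1 * th a1"
  proof -
    have "2 * dl (2 * r * (al * al - be * be)) = 2 * dl (al * th be - be * th al)"
      using W by (simp add: th_def)
    then show ?thesis
      by (simp add: dl_mult dl_diff dl_two dl_al dl_be th_dl[of al, unfolded dl_al] 
          th_dl[of be, unfolded dl_be] algebra_simps)
  qed
  have thal: "al * th al = a1 * th a1 + b1 * th b1"
  proof -
    have "2 * (al * th al) = 2 * (a1 * th a1 + b1 * th b1)"
      using arg_cong[OF al2, of th] by (simp add: th_mult th_add algebra_simps)
    then show ?thesis unfolding mult_cancel_left by simp
  qed
  have thbe: "be * th be = a1 * th b1 + b1 * th a1"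
  proof -
    have "2 * (be * th be) = 2 * (a1 * th b1 + b1 * th a1)"
      using arg_cong[OF be2, of th] by (simp add: th_mult th_two algebra_simps)
    then show ?thesis unfolding mult_cancel_left by simp
  qed
  have sq: "al * al - be * be = (a1 - b1) * (a1 - b1)" "al * al + be * be = (a1 + b1) * (a1 + b1)"
    by (simp_all add: al2 be2 algebra_simps)
  \<comment> \<open>Multiplied by \<open>al * be\<close>, the Wronskian involves \<open>al\<close>
    and \<open>be\<close> only through their squares and the derivatives of these. Written in
    \<open>a1\<close> and \<open>b1\<close> it becomes a multiple of the dilated Wronskian, which
    \<open>W1\<close> evaluates.\<close>
  have "2 * (al * be * r) * ((a1 - b1) * (a1 - b1)) = al * be * (2 * r * (al * al - be * be))"
    by (simp add: sq algebra_simps)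
  also have "\<dots> = (al * al) * (be * th be) - (be * be) * (al * th al)"
    unfolding W th_def by (simp add: algebra_simps)
  also have "\<dots> = (a1 * a1 - b1 * b1) * (a1 * th b1 - b1 * th a1)"
    by (simp add: al2 be2 thal thbe algebra_simps)
  also have "\<dots> = 2 * (2 * dl r * (al * al + be * be)) * ((a1 - b1) * (a1 - b1))"
    by (simp add: W1[symmetric] sq algebra_simps)
  finally have "2 * (al * be * r) * ((a1 - b1) * (a1 - b1)) =
      2 * (2 * dl r * (al * al + be * be)) * ((a1 - b1) * (a1 - b1))" .
  moreover have a1_0: "a1 $ 0 = 1"
    by (simp add: a1_def theta_even_def qsum_nth)
  then have "a1 - b1 \<noteq> 0"
    by (auto simp: b1_def fps_eq_iff power2_eq_square intro!: exI[of _ 0])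
  ultimately have rec: "al * be * r = 2 * dl r * (al * al + be * be)"
    unfolding mult_cancel_right mult_cancel_left by simp
  have z2: "2 * z = al * be * (al * al + be * be)"
    by (simp add: z_def fps_numeral_fps_const flip: mult.assoc)
  have zX: "16 * z = fps_X * theta_half 1 ^ 4"
  proof -
    have "theta_half 1 ^ 4 = (theta_half 1 * theta_half 1) * (theta_half 1 * theta_half 1)"
      by (simp add: power4_eq_xxxx mult_ac)
    also have "\<dots> = 4 * (theta_half 2 * theta_half 2) * (theta_even 2 * theta_even 2)"
      using theta_half_square[of 1] by (simp add: mult_ac)
    also have "\<dots> = 8 * theta_half 4 * theta_even 4 * (al * al + be * be)"
      using theta_half_square[of 2] theta_even_square[of 1] by (simp add: al_def be_def mult_ac)
    finally have "fps_X * theta_half 1 ^ 4 = 8 * (al * be * (al * al + be * be))"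
      by (simp add: al_def be_def mult_ac)
    then show ?thesis unfolding z2[symmetric] by simp
  qed
  have "fps_const 16 * z = fps_X * theta_half 1 ^ 4"
    using zX by (simp add: fps_numeral_fps_const)
  then have "(fps_const 16 * z) $ n = (fps_X * theta_half 1 ^ 4) $ n" for n by simp
  from this[of 0] this[of 1] have z01: "z $ 0 = 0" "z $ 1 = 1"
    by (auto simp: theta_half_nth_0 fps_power_zeroth)
  have "al * be \<noteq> 0"
  proof
    assume "al * be = 0"
    then have "2 * z = 0" using z2 by simp
    then have "z = 0" by simp
    with z01 show False by simp
  qed
  \<comment> \<open>\<open>z\<close> obeys the same recursion as \<open>r\<close> does in
    \<open>rec\<close>, so the quotient of the two is dilation invariant.\<close>
  moreover have "2 * (al * be) * (r * dl z) = 2 * (al * be) * (dl r * z)"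
  proof -
    have dz: "2 * dl z = a1 * b1 * (a1 * a1 + b1 * b1)"
      using arg_cong[OF z2, of dl] by (simp add: dl_mult dl_add dl_two dl_al dl_be)
    have "2 * (al * be) * (r * dl z) = (al * be * r) * (2 * dl z)" by (simp add: mult_ac)
    also have "\<dots> = dl r * (al * al + be * be) * ((2 * a1 * b1) * (a1 * a1 + b1 * b1))"
      unfolding rec dz by (simp only: mult_ac)
    also have "\<dots> = dl r * (al * be) * (2 * z)"
      unfolding al2[symmetric] be2[symmetric] z2 by (simp only: mult_ac)
    finally show ?thesis by (simp only: mult_ac)
  qed
  ultimately have "r * dl z = dl r * z"
    unfolding mult_cancel_left by simp
  then have "r * (z oo fps_X\<^sup>2) = (r oo fps_X\<^sup>2) * z" by (simp only: dl_def)
  then have "r = z"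
    by (rule dilate_proportional_imp_eq) (simp_all add: r[simplified] z01[simplified])
  with zX show ?thesis by simp
qed

section \<open>The Kronecker series\<close>

text \<open>
  The series \<open>\<Sum>x\<in>I. w x t^(e x) exp(p x u) exp(q x v)\<close>, as a power series in \<open>v\<close> (outermost) whose
  coefficients are power series in \<open>u\<close> over the power series in \<open>t\<close>.
\<close>

definition biexp_series :: "'i set \<Rightarrow> ('i \<Rightarrow> int) \<Rightarrow> ('i \<Rightarrow> real) \<Rightarrow> ('i \<Rightarrow> int) \<Rightarrow> ('i \<Rightarrow> int)
    \<Rightarrow> real fps fps fps" where
  "biexp_series I e w p q = Abs_fps (\<lambda>j. Abs_fps (\<lambda>i.
     qsum I e (\<lambda>x. w x * (of_int (p x) ^ i / fact i) * (of_int (q x) ^ j / fact j))))"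

lemma biexp_series_nth:
  "biexp_series I e w p q $ j $ i =
     qsum I e (\<lambda>x. w x * (of_int (p x) ^ i / fact i) * (of_int (q x) ^ j / fact j))"
  by (simp add: biexp_series_def)

lemma sum_divided_powers:
  fixes x y :: real
  shows "(\<Sum>k=0..n. (x ^ k / fact k) * (y ^ (n - k) / fact (n - k))) = (x + y) ^ n / fact n"
  using arg_cong[OF fps_exp_add_mult[of x y], of "\<lambda>f. f $ n"] by (simp add: fps_mult_nth)

text \<open>Multiplying exponentials adds their frequencies; on coefficients this is the binomial
  theorem in divided powers, once in u and once in v.\<close>

lemma biexp_series_mult:
  assumes "nonneg_finite_fibres I e" "nonneg_finite_fibres J e'"
  shows "biexp_series I e w p q * biexp_series J e' w' p' q' =
    biexp_series (I \<times> J) (\<lambda>(x, y). e x + e' y) (\<lambda>(x, y). w x * w' y)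
      (\<lambda>(x, y). p x + p' y) (\<lambda>(x, y). q x + q' y)" (is "?L = ?R")
proof (rule fps_ext, rule fps_ext)
  fix j i
  let ?E = "\<lambda>(x, y). e x + e' y"
  have "?L $ j $ i = (\<Sum>k=0..j. \<Sum>l=0..i. biexp_series I e w p q $ k $ l * biexp_series J e' w' p' q' $ (j - k) $ (i - l))"
    by (simp add: fps_mult_nth fps_sum_nth)
  also have "\<dots> = (\<Sum>k=0..j. \<Sum>l=0..i. qsum (I \<times> J) ?E (\<lambda>(x, y).
      (w x * (of_int (p x) ^ l / fact l) * (of_int (q x) ^ k / fact k)) *
      (w' y * (of_int (p' y) ^ (i - l) / fact (i - l)) * (of_int (q' y) ^ (j - k) / fact (j - k)))))"
    unfolding biexp_series_nth by (simp add: qsum_mult[OF assms])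
  also have "\<dots> = qsum (I \<times> J) ?E (\<lambda>z. \<Sum>k=0..j. \<Sum>l=0..i. (\<lambda>(x, y).
      (w x * (of_int (p x) ^ l / fact l) * (of_int (q x) ^ k / fact k)) *
      (w' y * (of_int (p' y) ^ (i - l) / fact (i - l)) * (of_int (q' y) ^ (j - k) / fact (j - k)))) z)"
    by (simp only: qsum_sum)
  also have "\<dots> = ?R $ j $ i"
    unfolding biexp_series_nth
  proof (rule qsum_cong[OF refl], goal_cases)
    case (1 z)
    obtain x y where z: "z = (x, y)" by (cases z)
    let ?P = "\<lambda>l. (real_of_int (p x) ^ l / fact l) * (of_int (p' y) ^ (i - l) / fact (i - l))"
    let ?Q = "\<lambda>k. (real_of_int (q x) ^ k / fact k) * (of_int (q' y) ^ (j - k) / fact (j - k))"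
    have "(\<Sum>k=0..j. \<Sum>l=0..i. 
      (w x * (of_int (p x) ^ l / fact l) * (of_int (q x) ^ k / fact k)) *
      (w' y * (of_int (p' y) ^ (i - l) / fact (i - l)) * (of_int (q' y) ^ (j - k) / fact (j - k))))
      = (\<Sum>k=0..j. \<Sum>l=0..i. (w x * w' y) * (?Q k * ?P l))"
      by (intro sum.cong refl) (simp add: mult_ac)
    also have "\<dots> = (w x * w' y) * ((\<Sum>k=0..j. ?Q k) * (\<Sum>l=0..i. ?P l))"
      unfolding sum_product by (simp only: sum_distrib_left)
    also have "\<dots> = (w x * w' y) * ((of_int (q x) + of_int (q' y)) ^ j / fact j *
        ((of_int (p x) + of_int (p' y)) ^ i / fact i))"
      by (simp only: sum_divided_powers)
    finally show ?case
      unfolding z prod.case by (simp only: of_int_add mult_ac)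
  qed
  finally show "?L $ j $ i = ?R $ j $ i" .
qed

lemma nonneg_finite_fibres_inj:
  assumes "nonneg_finite_fibres J e'" "inj_on f I" "\<And>i. i \<in> I \<Longrightarrow> f i \<in> J"
    "\<And>i. i \<in> I \<Longrightarrow> e' (f i) = e i"
  shows "nonneg_finite_fibres I e"
  unfolding nonneg_finite_fibres_def
proof (intro conjI allI ballI)
  fix n
  have "f ` {i\<in>I. e i \<le> n} \<subseteq> {j\<in>J. e' j \<le> n}" using assms(3,4) by auto
  then have "finite (f ` {i\<in>I. e i \<le> n})"
    by (rule finite_subset) (rule fibre_finite_le[OF assms(1)])
  then show "finite {i\<in>I. e i \<le> n}"
    by (rule finite_imageD) (rule inj_on_subset[OF assms(2)], auto)
qed (use fibre_nonneg[OF assms(1)] assms(3,4) in fastforce)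

section \<open>The sign-reversing involution\<close>

definition parity_sign :: "int \<Rightarrow> real" where
  "parity_sign k = (if even k then 1 else - 1)"

text \<open>The quadrants x y > 0 for x = a + 1/2 and y = b + 1/2, on which \<open>odd_prod\<close>
  is the positive exponent 4 x y.\<close>

definition same_sign :: "(int \<times> int) set" where
  "same_sign = {(a, b). (0 \<le> a \<and> 0 \<le> b) \<or> (a < 0 \<and> b < 0)}"

text \<open>
  With \<open>x = a + 1/2\<close> and \<open>y = b + 1/2\<close> this is \<open>1\<close> if \<open>x, y > 0\<close>, \<open>-1\<close> if \<open>x, y < 0\<close>, and \<open>0\<close> otherwise.
  Written as a difference of two half-plane indicators, it lets each half plane cancel separately.
\<close>

definition cross_sgn :: "int \<times> int \<Rightarrow> real" where
  "cross_sgn = (\<lambda>(a, b). of_bool (0 \<le> b) - of_bool (a < 0))"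

definition odd_prod :: "int \<times> int \<Rightarrow> int" where
  "odd_prod = (\<lambda>(a, b). (2 * a + 1) * (2 * b + 1))"

definition two_squares :: "int \<times> int \<Rightarrow> int" where
  "two_squares = (\<lambda>(m, n). 2 * m\<^sup>2 + 2 * n\<^sup>2)"

text \<open>A quadruple indexes a term of the Kronecker series times the theta product. Its exponent
  in t is 4 x y + 2 m^2 + 2 n^2; \<open>quad_diff\<close> and \<open>quad_sum\<close> are its
  frequencies in u and v, and \<open>quad_par\<close> is the sign from the theta factor.\<close>

definition quad_exp :: "(int \<times> int) \<times> (int \<times> int) \<Rightarrow> int" where
  "quad_exp = (\<lambda>(x, y). odd_prod x + two_squares y)"

definition quad_diff :: "(int \<times> int) \<times> (int \<times> int) \<Rightarrow> int" where
  "quad_diff = (\<lambda>((a, b), (m, n)). (a - b) + (m - n))"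

definition quad_sum :: "(int \<times> int) \<times> (int \<times> int) \<Rightarrow> int" where
  "quad_sum = (\<lambda>((a, b), (m, n)). (a + b + 1) + (m + n))"

definition quad_par :: "(int \<times> int) \<times> (int \<times> int) \<Rightarrow> real" where
  "quad_par = (\<lambda>(x, (m, n)). parity_sign (m + n))"

lemma nonneg_finite_fibres_same_sign: "nonneg_finite_fibres same_sign odd_prod"
proof (rule nonneg_finite_fibresI[where S = "\<lambda>n. {-n-1..n+1} \<times> {-n-1..n+1}"])
  have *: "0 \<le> odd_prod (a, b) \<and> a \<le> odd_prod (a, b)" if "0 \<le> a" "0 \<le> b" for a b
  proof -
    have "2 * a + 1 \<le> odd_prod (a, b)"
      using mult_left_mono[of 1 "2 * b + 1" "2 * a + 1"] that by (simp add: odd_prod_def)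
    with that show ?thesis by - (intro conjI; linarith)
  qed
  have sw: "odd_prod (a, b) = odd_prod (b, a)" "odd_prod (a, b) = odd_prod (-1 - a, -1 - b)" for a b
    by (simp_all add: odd_prod_def algebra_simps)
  have **: "0 \<le> odd_prod (a, b)" "\<bar>a\<bar> \<le> odd_prod (a, b) + 1" "\<bar>b\<bar> \<le> odd_prod (a, b) + 1"
    if "(a, b) \<in> same_sign" for a b
    using that *[of a b] *[of b a] *[of "-1-a" "-1-b"] *[of "-1-b" "-1-a"] sw[of a b]
      sw(1)[of "-1-a" "-1-b"]
    unfolding same_sign_def by (auto simp: abs_if)
  show "0 \<le> odd_prod i" if "i \<in> same_sign" for i using ** that by (cases i) auto
  show "i \<in> {- odd_prod i - 1..odd_prod i + 1} \<times> {- odd_prod i - 1..odd_prod i + 1}"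
    if "i \<in> same_sign" for i
    using **[of "fst i" "snd i"] that by (cases i) (auto simp: abs_if split: if_splits)
qed (auto intro!: monoI)

lemma nonneg_finite_fibres_two_squares: "nonneg_finite_fibres UNIV two_squares"
  using nonneg_finite_fibres_times[OF nonneg_finite_fibres_square[of 2] nonneg_finite_fibres_square[of 2]]
  by (simp add: two_squares_def case_prod_unfold)

lemma nonneg_finite_fibres_quad: "nonneg_finite_fibres (same_sign \<times> UNIV) quad_exp"
  using nonneg_finite_fibres_times[OF nonneg_finite_fibres_same_sign nonneg_finite_fibres_two_squares]
  by (simp add: quad_exp_def)

text \<open>The exponent e is indefinite on the half plane y > 0. With c = 2 y, positivity of
  \<open>quad_diff\<close> bounds x below, and completing squares gives 2 e \<ge> 4 c + (c + 2 n)^2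
  + (c - 2 m)^2. This bounds c, m and n, and then x.\<close>

lemma nonneg_finite_fibres_upper:
  "nonneg_finite_fibres {z. 0 \<le> snd (fst z) \<and> 0 < quad_diff z} quad_exp"
    (is "nonneg_finite_fibres ?T _")
proof -
  have bound: "0 \<le> e \<and> \<bar>a\<bar> \<le> 5 * e \<and> \<bar>b\<bar> \<le> 5 * e \<and> \<bar>m\<bar> \<le> 5 * e \<and> \<bar>n\<bar> \<le> 5 * e"
    if z: "((a, b), (m, n)) \<in> ?T" and e: "e = quad_exp ((a, b), (m, n))" for a b m n e
  proof -
    define c where "c = 2 * b + 1"
    have c: "c \<ge> 1" and ab: "2 * a + 1 \<ge> c + 2 + 2 * n - 2 * m"
      using z by (auto simp: quad_diff_def c_def)
    have e': "e = (2 * a + 1) * c + 2 * m\<^sup>2 + 2 * n\<^sup>2"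
      by (simp add: e quad_exp_def odd_prod_def two_squares_def c_def)
    have "(c + 2 + 2 * n - 2 * m) * c \<le> (2 * a + 1) * c"
      using ab c by (intro mult_right_mono) auto
    then have main: "4 * c + (c + 2 * n)\<^sup>2 + (c - 2 * m)\<^sup>2 \<le> 2 * e"
      unfolding e' by (simp add: power2_eq_square algebra_simps)
    have c2: "2 * c \<le> e" and "\<bar>c + 2 * n\<bar> \<le> 2 * e" "\<bar>c - 2 * m\<bar> \<le> 2 * e"
      using main zero_le_power2[of "c + 2 * n"] zero_le_power2[of "c - 2 * m"] c
        abs_le_square_int[of "c + 2 * n"] abs_le_square_int[of "c - 2 * m"] by linarith+
    then have mn: "\<bar>m\<bar> \<le> 2 * e" "\<bar>n\<bar> \<le> 2 * e" using c by linarith+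
    have "a \<le> e"
    proof (cases "a \<ge> 0")
      case True
      have "2 * a + 1 \<le> e - 2 * m\<^sup>2 - 2 * n\<^sup>2"
        using mult_left_mono[of 1 c "2 * a + 1"] True c unfolding e' by simp
      with True show ?thesis using zero_le_power2[of m] zero_le_power2[of n] by linarith
    next
      case False with c c2 show ?thesis by linarith
    qed
    moreover have "- (5 * e) \<le> a" using ab c mn by linarith
    moreover have "0 \<le> b" "4 * b + 2 \<le> e" using c c2 by (simp_all add: c_def)
    ultimately show ?thesis using mn by - (intro conjI; linarith)
  qed
  show ?thesis
  proof (rule nonneg_finite_fibresI[where
        S = "\<lambda>n. ({-5*n..5*n} \<times> {-5*n..5*n}) \<times> ({-5*n..5*n} \<times> {-5*n..5*n})"])
    fix z assume "z \<in> ?T"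
    moreover obtain a b m n where z: "z = ((a, b), (m, n))" by (metis surj_pair)
    ultimately have *: "((a, b), (m, n)) \<in> ?T" by simp
    note ** = bound[OF * refl]
    show "0 \<le> quad_exp z" using ** z by simp
    show "z \<in> ({-5*quad_exp z..5*quad_exp z} \<times> {-5*quad_exp z..5*quad_exp z}) \<times>
        ({-5*quad_exp z..5*quad_exp z} \<times> {-5*quad_exp z..5*quad_exp z})"
      using ** unfolding z mem_Times_iff fst_conv snd_conv atLeastAtMost_iff
      by - (intro conjI; linarith)
  next
    show "mono (\<lambda>n::int. ({-5*n..5*n} \<times> {-5*n..5*n}) \<times> ({-5*n..5*n} \<times> {-5*n..5*n}))"
      by (intro monoI Sigma_mono) auto
  qed auto
qed

text \<open>The map (x, y, m, n) -> (-y, -x, -n, -m) keeps the exponent and \<open>quad_diff\<close>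
  and carries x < 0 to y > 0.\<close>

lemma nonneg_finite_fibres_left:
  "nonneg_finite_fibres {z. fst (fst z) < 0 \<and> 0 < quad_diff z} quad_exp"
proof (rule nonneg_finite_fibres_inj[OF nonneg_finite_fibres_upper,
      where f = "\<lambda>((a, b), (m, n)). ((-1 - b, -1 - a), (- n, - m))"])
qed (auto simp: inj_on_def quad_diff_def quad_exp_def odd_prod_def two_squares_def algebra_simps)

text \<open>
  On the half plane \<open>y > 0\<close> reflect \<open>x\<close> with \<open>y\<close>, \<open>x + m\<close> and \<open>n\<close> fixed; this preserves the exponent and
  changes the parity of \<open>m\<close>.  On \<open>x < 0\<close> the roles of the coordinates are exchanged.  The condition
  on \<open>quad_diff\<close> makes the fibres over the half planes finite.
\<close>

lemma quad_cancel_pos: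
  fixes g :: "int \<Rightarrow> int \<Rightarrow> real"
  shows "qsum {z \<in> same_sign \<times> UNIV. 0 < quad_diff z} quad_exp
    (\<lambda>z. cross_sgn (fst z) * quad_par z * g (quad_diff z) (quad_sum z)) = 0"
proof -
  let ?T1 = "{z. 0 \<le> snd (fst z) \<and> 0 < quad_diff z}"
  let ?T2 = "{z. fst (fst z) < 0 \<and> 0 < quad_diff z}"
  let ?h = "\<lambda>z. quad_par z * g (quad_diff z) (quad_sum z)"
  have fin: "nonneg_finite_fibres (?T1 \<union> ?T2) quad_exp"
    using nonneg_finite_fibres_upper nonneg_finite_fibres_left
    unfolding nonneg_finite_fibres_def by (auto simp: Collect_disj_eq conj_disj_distribR)
  \<comment> \<open>Since 4 x y + 2 m^2 = 2 (m - y)^2 - 2 y^2 + 4 (x + m) y, the reflection is m ->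
    2 y - m; as 2 y is odd, the parity of m changes.\<close>
  have T1: "qsum ?T1 quad_exp ?h = 0"
    by (rule qsum_involution_eq_0[where f = "\<lambda>((a, b), (m, n)).
          ((a + 2 * m - 2 * b - 1, b), (2 * b + 1 - m, n))"])
      (auto simp: quad_diff_def quad_sum_def quad_exp_def quad_par_def parity_sign_def odd_prod_def
        two_squares_def power2_eq_square algebra_simps)
  have T2: "qsum ?T2 quad_exp ?h = 0"
    by (rule qsum_involution_eq_0[where f = "\<lambda>((a, b), (m, n)).
          ((a, b + 2 * n - 2 * a - 1), (m, 2 * a + 1 - n))"])
      (auto simp: quad_diff_def quad_sum_def quad_exp_def quad_par_def parity_sign_def odd_prod_def
        two_squares_def power2_eq_square algebra_simps)
  \<comment> \<open>The half planes overlap in the quadrant x < 0 < y, outside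
    \<open>same_sign\<close>, where \<open>cross_sgn\<close> vanishes. So the sum may be taken over
    their union and then split.\<close>
  have "qsum {z \<in> same_sign \<times> UNIV. 0 < quad_diff z} quad_exp (\<lambda>z. cross_sgn (fst z) * quad_par z * g (quad_diff z) (quad_sum z))
      = qsum (?T1 \<union> ?T2) quad_exp (\<lambda>z. cross_sgn (fst z) * quad_par z * g (quad_diff z) (quad_sum z))"
    by (rule qsum_nonzero_weights[OF fin, symmetric])
      (auto simp: same_sign_def cross_sgn_def split: if_splits)
  also have "\<dots> = qsum (?T1 \<union> ?T2) quad_exp
      (\<lambda>z. of_bool (0 \<le> snd (fst z)) * ?h z - of_bool (fst (fst z) < 0) * ?h z)"
    by (rule qsum_cong) (auto simp: cross_sgn_def)
  also have "\<dots> = qsum (?T1 \<union> ?T2) quad_exp (\<lambda>z. of_bool (0 \<le> snd (fst z)) * ?h z) -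
      qsum (?T1 \<union> ?T2) quad_exp (\<lambda>z. of_bool (fst (fst z) < 0) * ?h z)"
    by (rule qsum_diff)
  also have "qsum (?T1 \<union> ?T2) quad_exp (\<lambda>z. of_bool (0 \<le> snd (fst z)) * ?h z) =
      qsum ?T1 quad_exp (\<lambda>z. of_bool (0 \<le> snd (fst z)) * ?h z)"
    by (rule qsum_nonzero_weights[OF fin]) auto
  also have "\<dots> = qsum ?T1 quad_exp ?h" by (rule qsum_cong) auto
  also have "qsum (?T1 \<union> ?T2) quad_exp (\<lambda>z. of_bool (fst (fst z) < 0) * ?h z) =
      qsum ?T2 quad_exp (\<lambda>z. of_bool (fst (fst z) < 0) * ?h z)"
    by (rule qsum_nonzero_weights[OF fin]) auto
  also have "\<dots> = qsum ?T2 quad_exp ?h" by (rule qsum_cong) auto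
  finally show ?thesis by (simp add: T1 T2)
qed

text \<open>Exchanging x with y and m with n maps negative to positive \<open>quad_diff\<close>, so
  only terms of frequency 0 in u survive.\<close>

lemma quad_cancel:
  fixes g :: "int \<Rightarrow> int \<Rightarrow> real"
  shows "qsum (same_sign \<times> UNIV) quad_exp
      (\<lambda>z. cross_sgn (fst z) * quad_par z * g (quad_diff z) (quad_sum z)) =
    qsum {z \<in> same_sign \<times> UNIV. quad_diff z = 0} quad_exp
      (\<lambda>z. cross_sgn (fst z) * quad_par z * g (quad_diff z) (quad_sum z))"
proof -
  let ?w = "\<lambda>g z. cross_sgn (fst z) * quad_par z * g (quad_diff z) (quad_sum z)"
  let ?P = "{z \<in> same_sign \<times> UNIV. 0 < quad_diff z}"
  let ?N = "{z \<in> same_sign \<times> UNIV. quad_diff z < 0}"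
  let ?Z = "{z \<in> same_sign \<times> UNIV. quad_diff z = 0}"
  have fin: "nonneg_finite_fibres I quad_exp" if "I \<subseteq> same_sign \<times> UNIV" for I
    by (rule nonneg_finite_fibres_subset[OF nonneg_finite_fibres_quad that])
  have "qsum (?Z \<union> (?P \<union> ?N)) quad_exp (?w g) = qsum ?Z quad_exp (?w g) + qsum (?P \<union> ?N) quad_exp (?w g)"
    by (rule qsum_union, rule fin) auto
  also have "?Z \<union> (?P \<union> ?N) = same_sign \<times> UNIV" by auto
  also have "qsum (?P \<union> ?N) quad_exp (?w g) = qsum ?P quad_exp (?w g) + qsum ?N quad_exp (?w g)"
    by (rule qsum_union, rule fin) auto
  also have "qsum ?P quad_exp (?w g) = 0" by (rule quad_cancel_pos)
  also have "qsum ?N quad_exp (?w g) = qsum ?P quad_exp (?w (\<lambda>p q. g (- p) q))"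
  proof (rule qsum_reindex[where f = "\<lambda>((a, b), (m, n)). ((b, a), (n, m))"])
    show "bij_betw (\<lambda>((a, b), (m, n)). ((b, a), (n, m))) ?N ?P"
      by (rule bij_betw_byWitness[where f' = "\<lambda>((a, b), (m, n)). ((b, a), (n, m))"])
        (auto simp: same_sign_def quad_diff_def)
  next
    fix z assume z': "z \<in> ?N"
    obtain a b m n where z: "z = ((a, b), (m, n))" by (metis surj_pair)
    show "quad_exp ((\<lambda>((a, b), (m, n)). ((b, a), (n, m))) z) = quad_exp z"
      by (simp add: z quad_exp_def odd_prod_def two_squares_def mult.commute)
    have "cross_sgn (b, a) = cross_sgn (a, b)"
      using z' z by (auto simp: same_sign_def cross_sgn_def)
    moreover have "quad_diff ((b, a), (n, m)) = - quad_diff z" "quad_sum ((b, a), (n, m)) = quad_sum z"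
      "quad_par ((b, a), (n, m)) = quad_par z"
      by (simp_all add: z quad_diff_def quad_sum_def quad_par_def add_ac)
    ultimately show "?w (\<lambda>p q. g (- p) q) ((\<lambda>((a, b), (m, n)). ((b, a), (n, m))) z) = ?w g z"
      by (simp add: z)
  qed
  also have "\<dots> = 0" by (rule quad_cancel_pos)
  finally show ?thesis by simp
qed

text \<open>Twice F(u, v): negating both x and y supplies the second half of sinh, exchanging them
  that of cosh.\<close>

definition kronecker :: "real fps fps fps" where
  "kronecker = biexp_series same_sign odd_prod cross_sgn (\<lambda>(a, b). a - b) (\<lambda>(a, b). a + b + 1)"

text \<open>The kernel A(u) A(v) - B(u) B(v), indexed by r = m + n and s = m - n: these have equal
  parity, and r^2 + s^2 = 2 m^2 + 2 n^2.\<close>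

definition theta_product :: "real fps fps fps" where
  "theta_product = biexp_series UNIV two_squares (\<lambda>(m, n). parity_sign (m + n)) (\<lambda>(m, n). m - n) (\<lambda>(m, n). m + n)"

lemma kronecker_theta_nth:
  "(kronecker * theta_product) $ j $ i = qsum (same_sign \<times> UNIV) quad_exp
    (\<lambda>z. cross_sgn (fst z) * quad_par z *
      ((of_int (quad_diff z) ^ i / fact i) * (of_int (quad_sum z) ^ j / fact j)))"
  unfolding kronecker_def theta_product_def
    biexp_series_mult[OF nonneg_finite_fibres_same_sign nonneg_finite_fibres_two_squares] biexp_series_nth
  by (rule qsum_cong) (auto simp: quad_exp_def quad_diff_def quad_sum_def quad_par_def)

lemma kronecker_theta_nth_pos:
  assumes "i > 0"
  shows "(kronecker * theta_product) $ j $ i = 0"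
proof -
  have "(kronecker * theta_product) $ j $ i = qsum {z \<in> same_sign \<times> UNIV. quad_diff z = 0} quad_exp
    (\<lambda>z. cross_sgn (fst z) * quad_par z *
      ((of_int (quad_diff z) ^ i / fact i) * (of_int (quad_sum z) ^ j / fact j)))"
    unfolding kronecker_theta_nth
    by (rule quad_cancel[where g = "\<lambda>p q. (of_int p ^ i / fact i) * (of_int q ^ j / fact j)"])
  also have "\<dots> = qsum {z \<in> same_sign \<times> UNIV. quad_diff z = 0} quad_exp (\<lambda>_. 0)"
    by (rule qsum_cong) (use assms in auto)
  finally show ?thesis by simp
qed

section \<open>Taylor coefficients of the theta product and the first coefficient in v\<close>

definition theta_moment :: "int set \<Rightarrow> nat \<Rightarrow> real fps" where
  "theta_moment I i = qsum I (\<lambda>k. k\<^sup>2) (\<lambda>k. of_int k ^ i / fact i)"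

lemma nonneg_finite_fibres_squares: "nonneg_finite_fibres I (\<lambda>k::int. k\<^sup>2)"
  using nonneg_finite_fibres_subset[OF nonneg_finite_fibres_square[of 1]] by auto

lemma nonneg_finite_fibres_sum_squares: "nonneg_finite_fibres I (\<lambda>(k, l::int). k\<^sup>2 + l\<^sup>2)"
  by (rule nonneg_finite_fibres_subset[OF nonneg_finite_fibres_times
        [OF nonneg_finite_fibres_squares nonneg_finite_fibres_squares], of _ UNIV UNIV]) auto

lemma theta_product_nth:
  "theta_product $ j $ i = theta_moment {k. even k} j * theta_moment {k. even k} i -
    theta_moment {k. odd k} j * theta_moment {k. odd k} i"
proof -
  let ?ev = "{k :: int. even k}" and ?od = "{k :: int. odd k}"
  let ?e = "\<lambda>(k, l::int). k\<^sup>2 + l\<^sup>2"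
  let ?w = "\<lambda>(r, s). (of_int r ^ j / fact j) * (of_int s ^ i / fact i) :: real"
  have "theta_product $ j $ i = qsum {(m, n). even (m + n)} ?e (\<lambda>(r, s). parity_sign r * ?w (r, s))"
    unfolding theta_product_def biexp_series_nth
    by (rule qsum_reindex[OF bij_sum_diff_even]) (auto simp: two_squares_def power2_eq_square algebra_simps)
  also have "{(m, n :: int). even (m + n)} = ?ev \<times> ?ev \<union> ?od \<times> ?od" by auto
  also have "qsum (?ev \<times> ?ev \<union> ?od \<times> ?od) ?e (\<lambda>(r, s). parity_sign r * ?w (r, s)) =
      qsum (?ev \<times> ?ev) ?e (\<lambda>(r, s). parity_sign r * ?w (r, s)) + qsum (?od \<times> ?od) ?e (\<lambda>(r, s). parity_sign r * ?w (r, s))"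
    by (rule qsum_union[OF nonneg_finite_fibres_sum_squares]) auto
  also have "qsum (?ev \<times> ?ev) ?e (\<lambda>(r, s). parity_sign r * ?w (r, s)) = qsum (?ev \<times> ?ev) ?e ?w"
    by (rule qsum_cong) (auto simp: parity_sign_def)
  also have "qsum (?od \<times> ?od) ?e (\<lambda>(r, s). parity_sign r * ?w (r, s)) = qsum (?od \<times> ?od) ?e (\<lambda>z. - ?w z)"
    by (rule qsum_cong) (auto simp: parity_sign_def)
  also have "\<dots> = - qsum (?od \<times> ?od) ?e ?w" by (rule qsum_uminus)
  finally show ?thesis
    unfolding theta_moment_def
    by (simp add: qsum_mult[OF nonneg_finite_fibres_squares nonneg_finite_fibres_squares])
qed

text \<open>At frequency 0 in u, fixing N = x + y and K = m + n leaves only x free: m - n = y - x is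
  then solvable because N + K is odd. There are |N| choices, all with the sign of N.\<close>

lemma cross_sgn_fibre_sum:
  assumes "odd (N + K)"
  shows "(\<Sum>z\<in>{z \<in> {z \<in> same_sign \<times> UNIV. quad_diff z = 0}.
      (\<lambda>((a, b), (m, n)). (a + b + 1, m + n)) z = (N, K)}. cross_sgn (fst z)) = of_int N"
    (is "sum _ ?F = _")
proof -
  let ?h = "\<lambda>a. ((a, N - 1 - a), ((K + N - 1 - 2 * a) div 2, (K - N + 1 + 2 * a) div 2))"
  define A where "A = (if N > 0 then {0..<N} else {N..<0})"
  have half: "(K + N - 1 - 2 * a) div 2 + (K - N + 1 + 2 * a) div 2 = K"
    "(K + N - 1 - 2 * a) div 2 - (K - N + 1 + 2 * a) div 2 = N - 1 - 2 * a" for a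
    using assms by presburger+
  have bij: "bij_betw ?h A ?F"
  proof (rule bij_betw_byWitness[where f' = "\<lambda>z. fst (fst z)"])
    show "\<forall>a\<in>A. fst (fst (?h a)) = a" by simp
    show "\<forall>z\<in>?F. ?h (fst (fst z)) = z" by (auto simp: quad_diff_def)
    show "?h ` A \<subseteq> ?F" using half by (auto simp: A_def same_sign_def quad_diff_def split: if_splits)
    show "(\<lambda>z. fst (fst z)) ` ?F \<subseteq> A" by (auto simp: A_def same_sign_def)
  qed
  have "sum (\<lambda>z. cross_sgn (fst z)) ?F = (\<Sum>a\<in>A. cross_sgn (fst (?h a)))"
    by (rule sum.reindex_bij_betw[OF bij, symmetric])
  also have "\<dots> = (\<Sum>a\<in>A. if N > 0 then 1 else - 1)"
    by (rule sum.cong) (auto simp: A_def cross_sgn_def split: if_splits)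
  also have "\<dots> = of_int N" by (simp add: A_def)
  finally show ?thesis .
qed

text \<open>Where \<open>quad_diff\<close> vanishes the exponent is N^2 + K^2, and summing over x
  leaves the weight N (N + K) up to the parity sign of K. The term N K is odd in K and cancels; the
  term N^2 gives second moments.\<close>

lemma kronecker_theta_nth_1_0:
  "(kronecker * theta_product) $ 1 $ 0 =
    2 * (theta_moment {k. even k} 0 * theta_moment {k. odd k} 2 -
      theta_moment {k. odd k} 0 * theta_moment {k. even k} 2)"
proof -
  let ?Z = "{z \<in> same_sign \<times> (UNIV :: (int \<times> int) set). quad_diff z = 0}"
  let ?J = "{(N, K :: int). odd (N + K)}"
  let ?e = "\<lambda>(k, l::int). k\<^sup>2 + l\<^sup>2"
  let ?ev = "{k :: int. even k}" and ?od = "{k :: int. odd k}"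
  let ?f = "\<lambda>((a, b), (m, n)). (a + b + 1, m + n :: int)"
  let ?w = "\<lambda>z. cross_sgn (fst z) * quad_par z * of_int (quad_sum z)"
  have "(kronecker * theta_product) $ 1 $ 0 = qsum (same_sign \<times> UNIV) quad_exp ?w"
    unfolding kronecker_theta_nth by simp
  also have "\<dots> = qsum ?Z quad_exp ?w"
    by (rule quad_cancel[where g = "\<lambda>p q. of_int q"])
  also have "\<dots> = qsum ?J ?e (\<lambda>j. \<Sum>z\<in>{z \<in> ?Z. ?f z = j}. ?w z)"
  proof (rule qsum_fibres)
    show "nonneg_finite_fibres ?Z quad_exp"
      by (rule nonneg_finite_fibres_subset[OF nonneg_finite_fibres_quad]) auto
    show "?f z \<in> ?J" if "z \<in> ?Z" for z
      using that by (cases z) (auto simp: quad_diff_def; presburger)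
    show "quad_exp z = ?e (?f z)" if "z \<in> ?Z" for z
    proof -
      obtain a b m n where z: "z = ((a, b), (m, n))" by (metis surj_pair)
      with that have m: "m = n + b - a" by (auto simp: quad_diff_def)
      show ?thesis
        unfolding z m by (simp add: quad_exp_def odd_prod_def two_squares_def power2_eq_square algebra_simps)
    qed
  qed (rule nonneg_finite_fibres_sum_squares)
  also have "\<dots> = qsum ?J ?e (\<lambda>(N, K). parity_sign K * of_int N ^ 2 + parity_sign K * of_int (N * K))"
  proof (rule qsum_cong[OF refl], safe)
    fix N K :: int assume odd: "odd (N + K)"
    have "(\<Sum>z\<in>{z \<in> ?Z. ?f z = (N, K)}. ?w z) =
        (\<Sum>z\<in>{z \<in> ?Z. ?f z = (N, K)}. cross_sgn (fst z) * (parity_sign K * of_int (N + K)))"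
      by (rule sum.cong) (auto simp: quad_par_def quad_sum_def)
    also have "\<dots> = of_int N * (parity_sign K * of_int (N + K))"
      unfolding sum_distrib_right[symmetric] cross_sgn_fibre_sum[OF odd] ..
    finally show "(\<Sum>z\<in>{z \<in> ?Z. ?f z = (N, K)}. ?w z) = parity_sign K * of_int N ^ 2 + parity_sign K * of_int (N * K)"
      by (simp add: power2_eq_square algebra_simps)
  qed
  also have "\<dots> = qsum ?J ?e (\<lambda>(N, K). parity_sign K * of_int N ^ 2) + qsum ?J ?e (\<lambda>(N, K). parity_sign K * of_int (N * K))"
    unfolding qsum_add[symmetric] by (rule qsum_cong) auto
  also have "qsum ?J ?e (\<lambda>(N, K). parity_sign K * of_int (N * K)) = 0"
    by (rule qsum_involution_eq_0[where f = "\<lambda>(N, K). (N, - K)"]) (auto simp: parity_sign_def)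
  \<comment> \<open>\<open>parity_sign K\<close> gives the two classes opposite signs. The factors 2
    below undo the \<open>fact 2\<close> in \<open>theta_moment\<close>.\<close>
  also have "?J = ?od \<times> ?ev \<union> ?ev \<times> ?od" by auto
  also have "qsum (?od \<times> ?ev \<union> ?ev \<times> ?od) ?e (\<lambda>(N, K). parity_sign K * of_int N ^ 2) =
      qsum (?od \<times> ?ev) ?e (\<lambda>(N, K). parity_sign K * of_int N ^ 2) + qsum (?ev \<times> ?od) ?e (\<lambda>(N, K). parity_sign K * of_int N ^ 2)"
    by (rule qsum_union[OF nonneg_finite_fibres_sum_squares]) auto
  also have "qsum (?od \<times> ?ev) ?e (\<lambda>(N, K). parity_sign K * of_int N ^ 2) =
     qsum (?od \<times> ?ev) ?e (\<lambda>z. 2 * (\<lambda>(N, K). (of_int N ^ 2 / fact 2) * (of_int K ^ 0 / fact 0)) z)"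
    by (rule qsum_cong) (auto simp: parity_sign_def)
  also have "\<dots> = 2 * (theta_moment ?od 2 * theta_moment ?ev 0)"
    unfolding theta_moment_def qsum_mult[OF nonneg_finite_fibres_squares nonneg_finite_fibres_squares]
    by (subst qsum_cmult) (simp add: fps_numeral_fps_const)
  also have "qsum (?ev \<times> ?od) ?e (\<lambda>(N, K). parity_sign K * of_int N ^ 2) =
     qsum (?ev \<times> ?od) ?e (\<lambda>z. (- 2) * (\<lambda>(N, K). (of_int N ^ 2 / fact 2) * (of_int K ^ 0 / fact 0)) z)"
    by (rule qsum_cong) (auto simp: parity_sign_def)
  also have "\<dots> = - (2 * (theta_moment ?ev 2 * theta_moment ?od 0))"
    unfolding theta_moment_def qsum_mult[OF nonneg_finite_fibres_squares nonneg_finite_fibres_squares]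
    by (subst qsum_cmult) (simp add: fps_numeral_fps_const flip: fps_const_neg)
  finally show ?thesis by (simp add: algebra_simps)
qed

section \<open>Determinants\<close>

text \<open>The coefficients of \<open>y ^ j\<close> in the Newton basis \<open>\<Prod>l<k. y - x l\<close>.\<close>

fun newton_coeff :: "(nat \<Rightarrow> 'a::comm_ring_1) \<Rightarrow> nat \<Rightarrow> nat \<Rightarrow> 'a" where
  "newton_coeff x k 0 = (if k = 0 then 1 else 0)"
| "newton_coeff x k (Suc j) =
    (if k = 0 then 0 else newton_coeff x (k - 1) j) + x k * newton_coeff x k j"

lemma newton_coeff_eq_0: "j < k \<Longrightarrow> newton_coeff x k j = 0"
  by (induction j arbitrary: k) auto

lemma newton_coeff_diag: "newton_coeff x k k = 1"
  by (induction k) (auto simp: newton_coeff_eq_0)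

text \<open>Writing y = (y - x k) + x k, y times the k-th Newton product is the next product plus
  \<open>x k\<close> times the same one; this is the recursion of
  \<open>newton_coeff\<close>.\<close>

lemma power_eq_newton_sum:
  "j < n \<Longrightarrow> y ^ j = (\<Sum>k<n. (\<Prod>l<k. y - x l) * newton_coeff x k j)"
proof (induction j arbitrary: n)
  case 0
  then have "(\<Sum>k<n. (\<Prod>l<k. y - x l) * newton_coeff x k 0) =
      (\<Sum>k\<in>{0}. (\<Prod>l<k. y - x l) * newton_coeff x k 0)"
    by (intro sum.mono_neutral_right) auto
  then show ?case by simp
next
  case (Suc j)
  then obtain n' where n: "n = Suc n'" "j < n'" by (cases n) auto
  let ?p = "\<lambda>k. \<Prod>l<k. y - x l"
  have "(\<Sum>k<n. ?p k * newton_coeff x k (Suc j)) =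
      (\<Sum>k<n. ?p k * (if k = 0 then 0 else newton_coeff x (k - 1) j)) +
      (\<Sum>k<n. ?p k * (x k * newton_coeff x k j))"
    by (simp add: algebra_simps sum.distrib)
  also have "(\<Sum>k<n. ?p k * (if k = 0 then 0 else newton_coeff x (k - 1) j)) =
      (\<Sum>k<n'. ?p (Suc k) * newton_coeff x k j)"
    unfolding n sum.lessThan_Suc_shift by simp
  also have "(\<Sum>k<n. ?p k * (x k * newton_coeff x k j)) = (\<Sum>k<n'. ?p k * (x k * newton_coeff x k j))"
    unfolding n using n(2) by (simp add: newton_coeff_eq_0)
  also have "(\<Sum>k<n'. ?p (Suc k) * newton_coeff x k j) + \<dots> = y * (\<Sum>k<n'. ?p k * newton_coeff x k j)"
    by (simp add: sum_distrib_left algebra_simps flip: sum.distrib)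
  also have "\<dots> = y ^ Suc j" using Suc.IH[OF n(2)] by simp
  finally show ?case by simp
qed

text \<open>LU decomposition: the Newton products evaluated at the nodes are lower triangular, and
  \<open>newton_coeff\<close> is upper unitriangular.\<close>

lemma det_vandermonde:
  fixes x :: "nat \<Rightarrow> 'a::comm_ring_1"
  shows "det (mat n n (\<lambda>(i, j). x i ^ j)) = (\<Prod>i<n. \<Prod>l<i. x i - x l)"
proof -
  define L where "L = mat n n (\<lambda>(i, k). \<Prod>l<k. x i - x l)"
  define U where "U = mat n n (\<lambda>(k, j). newton_coeff x k j)"
  have L: "L \<in> carrier_mat n n" and U: "U \<in> carrier_mat n n" by (simp_all add: L_def U_def)
  have "mat n n (\<lambda>(i, j). x i ^ j) = L * U"
    by (rule eq_matI) (auto simp: L_def U_def scalar_prod_def power_eq_newton_sum[of _ n _ x]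
        lessThan_atLeast0)
  also have "det (L * U) = det L * det U" by (rule det_mult[OF L U])
  also have "det L = (\<Prod>i<n. \<Prod>l<i. x i - x l)"
  proof -
    have "det L = prod_list (diag_mat L)"
    proof (rule det_lower_triangular[OF _ L])
      fix i j assume ij: "i < j" "j < n"
      then have "(\<Prod>l<j. x i - x l) = 0"
        by (intro prod_zero) auto
      with ij show "L $$ (i, j) = 0" by (simp add: L_def)
    qed
    then show ?thesis by (simp add: prod_list_diag_prod L_def lessThan_atLeast0)
  qed
  also have "det U = 1"
  proof -
    have "det U = prod_list (diag_mat U)"
      by (rule det_upper_triangular[OF _ U]) (auto simp: U_def newton_coeff_eq_0)
    then show ?thesis by (simp add: prod_list_diag_prod U_def newton_coeff_diag)
  qed
  finally show ?thesis by simp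
qed

lemma det_scale_rows_cols:
  fixes M :: "nat \<Rightarrow> nat \<Rightarrow> 'a::comm_ring_1"
  shows "det (mat n n (\<lambda>(i, j). c i * d j * M i j)) =
    (\<Prod>i<n. c i) * (\<Prod>j<n. d j) * det (mat n n (\<lambda>(i, j). M i j))"
proof -
  have "det (mat n n (\<lambda>(i, j). c i * d j * M i j)) =
      (\<Sum>p | p permutes {0..<n}. signof p * (\<Prod>i=0..<n. c i * d (p i) * M i (p i)))"
    by (subst det_def') (auto intro!: sum.cong prod.cong)
  also have "\<dots> = (\<Sum>p | p permutes {0..<n}. (\<Prod>i<n. c i) * (\<Prod>j<n. d j) *
      (signof p * (\<Prod>i=0..<n. M i (p i))))"
  proof (rule sum.cong[OF refl])
    fix p assume "p \<in> {p. p permutes {0..<n}}"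
    then have "(\<Prod>i=0..<n. d (p i)) = (\<Prod>j=0..<n. d j)"
      by (simp add: prod.permute[of p _ d] o_def)
    then show "signof p * (\<Prod>i=0..<n. c i * d (p i) * M i (p i)) =
        (\<Prod>i<n. c i) * (\<Prod>j<n. d j) * (signof p * (\<Prod>i=0..<n. M i (p i)))"
      by (simp add: prod.distrib lessThan_atLeast0 mult_ac)
  qed
  also have "\<dots> = (\<Prod>i<n. c i) * (\<Prod>j<n. d j) * det (mat n n (\<lambda>(i, j). M i j))"
    unfolding sum_distrib_left[symmetric]
    by (subst det_def'[of "mat n n (\<lambda>(i, j). M i j)" n]) (auto intro!: sum.cong prod.cong arg_cong2[where f = "(*)"])
  finally show ?thesis .
qed

text \<open>Andreief's identity. Expand both determinants; for each permutation p in the first, the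
  sum over the second is the moment determinant with rows permuted by p. The two signs of p cancel,
  and all m! permutations contribute equally.\<close>

lemma andreief:
  assumes "nonneg_finite_fibres I e"
  shows "qsum ({0..<m} \<rightarrow>\<^sub>E I) (\<lambda>z. \<Sum>j=0..<m. e (z j))
      (\<lambda>z. det (mat m m (\<lambda>(j, a). u a (z j))) * det (mat m m (\<lambda>(j, b). v b (z j)))) =
    fact m * det (mat m m (\<lambda>(a, b). qsum I e (\<lambda>i. u a i * v b i)))"
    (is "qsum ?T ?e ?w = _ * det ?Q")
proof -
  let ?P = "{p. p permutes {0..<m}}"
  have detm: "det (mat m m (\<lambda>(j, a). h a (z j))) =
      (\<Sum>p\<in>?P. of_int (sign p) * (\<Prod>j=0..<m. h (p j) (z j)))" for h :: "nat \<Rightarrow> 'a \<Rightarrow> real" and z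
    by (subst det_def') (auto intro!: sum.cong prod.cong arg_cong2[where f = "(*)"])
  have "?w z = (\<Sum>p\<in>?P. \<Sum>r\<in>?P. (of_int (sign p) * of_int (sign r)) * (\<Prod>j=0..<m. u (p j) (z j) * v (r j) (z j)))"
    for z
    unfolding detm sum_product by (intro sum.cong refl) (simp add: prod.distrib mult_ac)
  then have "qsum ?T ?e ?w = (\<Sum>p\<in>?P. \<Sum>r\<in>?P. fps_const (of_int (sign p) * of_int (sign r)) *
      qsum ?T ?e (\<lambda>z. \<Prod>j=0..<m. u (p j) (z j) * v (r j) (z j)))"
    by (simp only: qsum_sum qsum_cmult)
  also have "\<dots> = (\<Sum>p\<in>?P. \<Sum>r\<in>?P. fps_const (of_int (sign p) * of_int (sign r)) *
      (\<Prod>j=0..<m. qsum I e (\<lambda>i. u (p j) i * v (r j) i)))"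
    by (subst prod_qsum) (auto simp: assms)
  also have "\<dots> = (\<Sum>p\<in>?P. of_int (sign p) * (\<Sum>r\<in>?P. of_int (sign r) *
      (\<Prod>j=0..<m. qsum I e (\<lambda>i. u (p j) i * v (r j) i))))"
    by (simp add: sum_distrib_left fps_of_int mult.assoc flip: fps_const_mult)
  also have "\<dots> = (\<Sum>p\<in>?P. det ?Q)"
  proof (rule sum.cong[OF refl])
    fix p assume p: "p \<in> ?P"
    have "(\<Sum>r\<in>?P. of_int (sign r) * (\<Prod>j=0..<m. qsum I e (\<lambda>i. u (p j) i * v (r j) i))) =
        det (mat m m (\<lambda>(i, j). ?Q $$ (p i, j)))"
    proof (subst det_def')
      show "(\<Sum>r\<in>?P. of_int (sign r) * (\<Prod>j=0..<m. qsum I e (\<lambda>i. u (p j) i * v (r j) i))) =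
        (\<Sum>r\<in>?P. of_int (sign r) * (\<Prod>i=0..<m. mat m m (\<lambda>(i, j). ?Q $$ (p i, j)) $$ (i, r i)))"
      proof (intro sum.cong prod.cong refl arg_cong2[where f = "(*)"])
        fix r i assume r: "r \<in> ?P" and i: "i \<in> {0..<m}"
        have "r i < m" "p i < m"
          using r p i permutes_in_image[of r "{0..<m}" i] permutes_in_image[of p "{0..<m}" i] by auto
        with i show "qsum I e (\<lambda>k. u (p i) k * v (r i) k) =
            mat m m (\<lambda>(i, j). ?Q $$ (p i, j)) $$ (i, r i)" by simp
      qed
    qed simp
    also have "\<dots> = of_int (sign p) * det ?Q"
      by (rule det_permute_rows[where n = m]) (use p in auto)
    finally have "of_int (sign p) * (\<Sum>r\<in>?P. of_int (sign r) *
        (\<Prod>j=0..<m. qsum I e (\<lambda>i. u (p j) i * v (r j) i))) = of_int (sign p * sign p) * det ?Q"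
      by (simp only: of_int_mult mult.assoc)
    then show "of_int (sign p) * (\<Sum>r\<in>?P. of_int (sign r) *
        (\<Prod>j=0..<m. qsum I e (\<lambda>i. u (p j) i * v (r j) i))) = det ?Q"
      by (simp only: sign_idempotent of_int_1 mult_1_left)
  qed
  also have "\<dots> = fact m * det ?Q"
    by (simp add: card_permutations[of _ m])
  finally show ?thesis .
qed

text \<open>The series f(v) in the outer variable, whereas \<open>fps_const f\<close> is f(u) in the
  inner one.\<close>

definition fps_outer :: "'a::comm_ring_1 fps \<Rightarrow> 'a fps fps" where
  "fps_outer f = Abs_fps (\<lambda>j. fps_const (f $ j))"

lemma fps_outer_nth [simp]: "fps_outer f $ j = fps_const (f $ j)"
  by (simp add: fps_outer_def)

lemma fps_outer_mult: "fps_outer (f * g) = fps_outer f * fps_outer g"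
  by (rule fps_ext, rule fps_ext) (simp add: fps_mult_nth[of "fps_outer f"] fps_mult_nth[of f] fps_sum_nth)

lemma fps_outer_diff: "fps_outer (f - g) = fps_outer f - fps_outer g"
  by (rule fps_ext) simp

lemma fps_outer_const: "fps_outer (fps_const c) = fps_const (fps_const c)"
  by (rule fps_ext) simp

lemma fps_outer_1: "fps_outer 1 = 1"
  by (rule fps_ext) simp

text \<open>Here g is the square of the variable times \<open>fps_shift 2 g\<close>. The resulting
  shift by 2 k makes the LU factors below triangular.\<close>

lemma shifted_power_nth:
  fixes f g :: "'a::comm_ring_1 fps"
  assumes "g $ 0 = 0" "g $ 1 = 0"
  shows "(f * g ^ k) $ n = (if n < 2 * k then 0 else (f * fps_shift 2 g ^ k) $ (n - 2 * k))"
proof -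
  have "fps_shift 2 g * fps_X ^ 2 = g"
  proof (rule fps_ext)
    fix n :: nat
    have "n = 0 \<or> n = 1 \<or> 2 \<le> n" by linarith
    then show "(fps_shift 2 g * fps_X ^ 2) $ n = g $ n"
      unfolding fps_X_power_mult_right_nth fps_shift_nth
      using assms by (elim disjE) (simp_all only: le_add_diff_inverse2, simp_all)
  qed
  then have "g ^ k = fps_shift 2 g ^ k * fps_X ^ (2 * k)"
    by (metis power_mult power_mult_distrib)
  then have "f * g ^ k = (f * fps_shift 2 g ^ k) * fps_X ^ (2 * k)" by (simp add: mult.assoc)
  then show ?thesis by (simp only: fps_X_power_mult_right_nth)
qed

text \<open>F = P(u) R(v) / (1 - S(u) S(v)). The terms P(u) S(u)^k R(v) S(v)^k of the geometric
  series factor the coefficient matrix into triangular matrices with diagonal entries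
  \<open>P $ 0 * (S $ 2) ^ k\<close> and \<open>R $ 1 * (S $ 2) ^ k\<close>.\<close>

lemma det_odd_even_coeffs:
  fixes F :: "'a::comm_ring_1 fps fps" and S P R :: "'a fps"
  assumes F: "F * (1 - fps_const S * fps_outer S) = fps_const P * fps_outer R"
    and S: "S $ 0 = 0" "S $ 1 = 0" and R: "R $ 0 = 0"
  shows "det (mat m m (\<lambda>(i, j). F $ (2 * j + 1) $ (2 * i))) = (P $ 0 * R $ 1) ^ m * (S $ 2) ^ (m * (m - 1))"
proof -
  \<comment> \<open>Geometric series with remainder; for \<open>n = m\<close> the remainder is
    divisible by u^(2m) and does not reach the rows \<open>i < m\<close>.\<close>
  have expand: "F = (\<Sum>k<n. fps_const (P * S ^ k) * fps_outer (R * S ^ k)) +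
      fps_const (S ^ n) * fps_outer (S ^ n) * F" for n
  proof (induction n)
    case (Suc n)
    have "F = fps_const P * fps_outer R + fps_const S * fps_outer S * F"
      using F by (simp add: algebra_simps)
    then have "fps_const (S ^ n) * fps_outer (S ^ n) * F =
        fps_const (S ^ n) * fps_outer (S ^ n) * (fps_const P * fps_outer R + fps_const S * fps_outer S * F)"
      by simp
    also have "\<dots> = fps_const (P * S ^ n) * fps_outer (R * S ^ n) +
        fps_const (S ^ Suc n) * fps_outer (S ^ Suc n) * F"
      by (simp add: fps_outer_mult algebra_simps flip: fps_const_mult)
    finally show ?case using Suc by (simp add: algebra_simps)
  qed (simp add: fps_outer_1)
  define L where "L = mat m m (\<lambda>(i, k). (P * S ^ k) $ (2 * i))"
  define U where "U = mat m m (\<lambda>(k, j). (R * S ^ k) $ (2 * j + 1))"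
  have L: "L \<in> carrier_mat m m" and U: "U \<in> carrier_mat m m" by (simp_all add: L_def U_def)
  have "F $ (2 * j + 1) $ (2 * i) = (\<Sum>k<m. (P * S ^ k) $ (2 * i) * (R * S ^ k) $ (2 * j + 1))"
    if "i < m" for i j
  proof -
    have "(fps_const (S ^ m) * fps_outer (S ^ m) * F) $ (2 * j + 1) $ (2 * i) =
        ((fps_outer (S ^ m) * F) $ (2 * j + 1) * S ^ m) $ (2 * i)"
      unfolding mult.assoc fps_mult_left_const_nth by (simp only: mult.commute)
    also have "\<dots> = 0" using shifted_power_nth[OF S] that by simp
    finally show ?thesis
      by (subst expand[of m]) (simp add: fps_sum_nth)
  qed
  then have "mat m m (\<lambda>(i, j). F $ (2 * j + 1) $ (2 * i)) = L * U"
    by (intro eq_matI) (auto simp: L_def U_def scalar_prod_def lessThan_atLeast0)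
  then have "det (mat m m (\<lambda>(i, j). F $ (2 * j + 1) $ (2 * i))) = det L * det U"
    by (simp add: det_mult[OF L U])
  also have "det L = (\<Prod>k<m. P $ 0 * (S $ 2) ^ k)"
  proof -
    have "det L = prod_list (diag_mat L)"
      by (rule det_lower_triangular[OF _ L]) (auto simp: L_def shifted_power_nth[OF S])
    then show ?thesis
      by (simp add: prod_list_diag_prod L_def lessThan_atLeast0 shifted_power_nth[OF S] fps_power_zeroth
          numeral_2_eq_2)
  qed
  also have "det U = (\<Prod>k<m. R $ 1 * (S $ 2) ^ k)"
  proof -
    have "det U = prod_list (diag_mat U)"
      by (rule det_upper_triangular[OF _ U])
        (auto simp: U_def shifted_power_nth[OF S])
    moreover have "(R * S ^ k) $ (2 * k + 1) = R $ 1 * (S $ 2) ^ k" for k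
      unfolding shifted_power_nth[OF S] by (simp add: fps_mult_nth R fps_power_zeroth numeral_2_eq_2)
    ultimately show ?thesis
      by (simp add: prod_list_diag_prod U_def lessThan_atLeast0)
  qed
  also have "(\<Prod>k<m. P $ 0 * (S $ 2) ^ k) * (\<Prod>k<m. R $ 1 * (S $ 2) ^ k) =
      (P $ 0 * R $ 1) ^ m * ((\<Prod>k<m. (S $ 2) ^ k) * (\<Prod>k<m. (S $ 2) ^ k))"
    by (simp add: prod.distrib power_mult_distrib mult_ac)
  also have "(\<Prod>k<m. (S $ 2) ^ k) * (\<Prod>k<m. (S $ 2) ^ k) = (S $ 2) ^ (m * (m - 1))"
  proof (induction m)
    case (Suc m)
    have "Suc m * (Suc m - 1) = m * (m - 1) + m + m" by (cases m) auto
    with Suc show ?case by (simp add: power_add mult_ac)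
  qed simp
  finally show ?thesis .
qed

section \<open>Evaluation of the moment determinant\<close>

lemma theta_moment_1: 
  assumes "\<And>k. k \<in> I \<Longrightarrow> - k \<in> I"
  shows "theta_moment I 1 = 0"
  unfolding theta_moment_def
  by (rule qsum_involution_eq_0[where f = uminus]) (use assms in auto)

lemma theta_moment_even_0: "theta_moment {k. even k} 0 = theta_even 4"
  unfolding theta_even_def theta_moment_def
  by (rule qsum_reindex[OF bij_even_int, symmetric]) (auto simp: power2_eq_square)

lemma theta_moment_odd_0: "theta_moment {k. odd k} 0 = fps_X * theta_half 4"
proof -
  have "fps_X ^ 1 * theta_half 4 = qsum UNIV (\<lambda>k. int 1 + 4 * (k\<^sup>2 + k)) (\<lambda>_. 1)"
    unfolding theta_half_def by (rule fps_X_power_mult_qsum[OF nonneg_finite_fibres_square_add]) simp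
  also have "\<dots> = theta_moment {k. odd k} 0"
    unfolding theta_moment_def
    by (rule qsum_reindex[OF bij_odd_int]) (auto simp: power2_eq_square algebra_simps)
  finally show ?thesis by simp
qed

text \<open>The heat equation: the factor k^2 brought down by t d/dt is also that of a second
  derivative in u. The 2 undoes \<open>fact 2\<close>.\<close>

lemma fps_X_deriv_theta_moment_0: "fps_X * fps_deriv (theta_moment I 0) = 2 * theta_moment I 2"
proof -
  have "fps_X * fps_deriv (theta_moment I 0) = qsum I (\<lambda>k. k\<^sup>2) (\<lambda>k. 2 * (of_int k ^ 2 / fact 2))"
    unfolding theta_moment_def fps_X_mult_deriv_qsum by (rule qsum_cong) auto
  then show ?thesis
    unfolding qsum_cmult theta_moment_def by (simp add: fps_numeral_fps_const)
qed

text \<open>The Taylor coefficient of F(u, v) at u^(2i) v^(2j+1), that is, the moment with its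
  factorials kept.\<close>

definition kronecker_coeff :: "nat \<Rightarrow> nat \<Rightarrow> real fps" where
  "kronecker_coeff i j = qsum ({0..} \<times> {0..}) odd_prod
     (\<lambda>(a, b). (of_int (a - b) ^ (2 * i) / fact (2 * i)) * (of_int (a + b + 1) ^ (2 * j + 1) / fact (2 * j + 1)))"

text \<open>Negating x and y changes the sign of both \<open>cross_sgn\<close> and the odd power of
  x + y, so the two quadrants contribute equally.\<close>

lemma kronecker_nth: "kronecker $ (2 * j + 1) $ (2 * i) = 2 * kronecker_coeff i j"
proof -
  let ?N = "{0..} \<times> {0..} :: (int \<times> int) set" and ?M = "{..<0} \<times> {..<0} :: (int \<times> int) set"
  let ?f = "\<lambda>(a, b). (-1 - a, -1 - b) :: int \<times> int"
  let ?w = "\<lambda>(a, b). (of_int (a - b) ^ (2 * i) / fact (2 * i)) * (of_int (a + b + 1) ^ (2 * j + 1) / fact (2 * j + 1)) :: real"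
  have neg: "((- n) ^ (2 * i) / c) * ((- N) ^ (2 * j + 1) / d) = - ((n ^ (2 * i) / c) * (N ^ (2 * j + 1) / d))"
    for n N c d :: real by simp
  have U: "same_sign = ?N \<union> ?M" by (auto simp: same_sign_def)
  have "kronecker $ (2 * j + 1) $ (2 * i) = qsum same_sign odd_prod (\<lambda>z. cross_sgn z * ?w z)"
    unfolding kronecker_def biexp_series_nth by (rule qsum_cong) auto
  also have "\<dots> = qsum ?N odd_prod (\<lambda>z. cross_sgn z * ?w z) + qsum ?M odd_prod (\<lambda>z. cross_sgn z * ?w z)"
    unfolding U by (rule qsum_union) (use nonneg_finite_fibres_same_sign U in auto)
  also have "qsum ?N odd_prod (\<lambda>z. cross_sgn z * ?w z) = qsum ?N odd_prod ?w"
    by (rule qsum_cong) (auto simp: cross_sgn_def)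
  also have "qsum ?M odd_prod (\<lambda>z. cross_sgn z * ?w z) = qsum ?N odd_prod ?w"
  proof (rule qsum_reindex[where f = ?f])
    show "bij_betw ?f ?M ?N"
      by (rule bij_betw_byWitness[where f' = ?f]) auto
    fix z assume z: "z \<in> ?M"
    obtain a b where ab: "z = (a, b)" by (cases z)
    show "odd_prod (?f z) = odd_prod z" by (simp add: ab odd_prod_def algebra_simps)
    have "?w (?f z) = (of_int (- (a - b)) ^ (2 * i) / fact (2 * i)) *
        (of_int (- (a + b + 1)) ^ (2 * j + 1) / fact (2 * j + 1))"
      unfolding ab prod.case by (intro arg_cong2[where f = "(*)"] arg_cong2[where f = "(/)"] refl
          arg_cong2[where f = "(^)"] arg_cong[where f = of_int]) auto
    also have "\<dots> = - ?w z"
      unfolding ab prod.case of_int_minus by (rule neg)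
    also have "- ?w z = cross_sgn z * ?w z" using z ab by (auto simp: cross_sgn_def)
    finally show "?w (?f z) = cross_sgn z * ?w z" .
  qed
  finally show ?thesis by (simp add: kronecker_coeff_def)
qed

lemma kronecker_nth_0_0: "kronecker $ 0 $ 0 = 0"
  unfolding kronecker_def biexp_series_nth
  by (rule qsum_involution_eq_0[where f = "\<lambda>(a, b). (-1 - a, -1 - b)"])
    (auto simp: same_sign_def cross_sgn_def odd_prod_def algebra_simps)

text \<open>Both claims rest on s = \<open>S $ 2\<close>: the LU decomposition gives the determinant
  as a power of s, the case of size 1 identifies s with the (0, 0) moment, and the formula for s as
  a quotient is the Wronskian relation.\<close>

lemma det_kronecker_coeff:
  shows "det (mat m m (\<lambda>(i, j). kronecker_coeff i j)) = kronecker_coeff 0 0 ^ (m\<^sup>2)" (is ?det)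
    and "2 * kronecker_coeff 0 0 * (theta_even 4 * theta_even 4 - fps_X * theta_half 4 * (fps_X * theta_half 4)) =
      theta_even 4 * (fps_X * fps_deriv (fps_X * theta_half 4)) -
      fps_X * theta_half 4 * (fps_X * fps_deriv (theta_even 4))" (is ?wronskian)
proof -
  define A where "A = Abs_fps (theta_moment {k. even k})"
  define B where "B = Abs_fps (theta_moment {k. odd k})"
  \<comment> \<open>The change of basis is chosen so that a(u) a(v) - b(u) b(v) = E (A(u) A(v) -
    B(u) B(v)), with b(0) = 0 and a(0) = E.\<close>
  define E where "E = A $ 0 * A $ 0 - B $ 0 * B $ 0"
  define a where "a = fps_const (A $ 0) * A - fps_const (B $ 0) * B"
  define b where "b = fps_const (A $ 0) * B - fps_const (B $ 0) * A"
  \<comment> \<open>The coefficients are themselves power series, so inverting \<open>a\<close>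
    requires an inverse of \<open>E\<close>, which exists as \<open>E $ 0 = 1\<close>.\<close>
  define y where "y = inverse E"
  define ai where "ai = fps_right_inverse a y"
  define h where "h = Abs_fps (\<lambda>j. (kronecker * theta_product) $ j $ 0)"
  define S where "S = b * ai"
  define P where "P = fps_const E * ai"
  define R where "R = h * ai"
  have "A $ 0 $ 0 = 1" "B $ 0 $ 0 = 0"
  proof -
    have "{k::int. k = 0} = {0}" by auto
    then show "A $ 0 $ 0 = 1" by (simp add: A_def theta_moment_even_0 theta_even_def qsum_nth)
    show "B $ 0 $ 0 = 0" by (simp add: B_def theta_moment_odd_0)
  qed
  then have Ey: "E * y = 1"
    unfolding y_def by (intro inverse_mult_eq_1') (simp add: E_def)
  have a0: "a $ 0 = E" by (simp add: a_def E_def)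
  have aai: "a * ai = 1" unfolding ai_def by (rule fps_right_inverse) (simp add: a0 Ey)
  have ai0: "ai $ 0 = y" by (simp add: ai_def)
  have A1: "A $ 1 = 0" "B $ 1 = 0"
    unfolding A_def B_def fps_nth_Abs_fps by (rule theta_moment_1; simp)+
  have theta: "theta_product = fps_const A * fps_outer A - fps_const B * fps_outer B"
    by (rule fps_ext, rule fps_ext) (simp add: theta_product_nth A_def B_def mult.commute)
  have H: "kronecker * theta_product = fps_outer h"
  proof (rule fps_ext, rule fps_ext)
    fix j i show "(kronecker * theta_product) $ j $ i = fps_outer h $ j $ i"
      by (cases "i = 0") (auto simp: h_def kronecker_theta_nth_pos)
  qed
  have Etheta: "fps_const (fps_const E) * theta_product = fps_const a * fps_outer a - fps_const b * fps_outer b"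
    unfolding theta a_def b_def E_def fps_outer_diff fps_outer_mult fps_outer_const
    by (simp add: algebra_simps flip: fps_const_sub fps_const_mult)
  have unit: "(fps_const a * fps_outer a) * (fps_const ai * fps_outer ai) = 1"
  proof -
    have "fps_const a * fps_const ai = 1" using aai by (simp add: fps_const_mult)
    moreover have "fps_outer a * fps_outer ai = 1" using aai by (simp add: fps_outer_1 flip: fps_outer_mult)
    ultimately show ?thesis by (metis mult.assoc mult.left_commute mult_1_right)
  qed
  \<comment> \<open>Multiply the kernel by E and divide by a(u) a(v): S = b/a, P = E/a, R =
    h/a.\<close>
  have F: "kronecker * (1 - fps_const S * fps_outer S) = fps_const P * fps_outer R"
  proof -
    have "1 - fps_const S * fps_outer S =
        (fps_const a * fps_outer a - fps_const b * fps_outer b) * (fps_const ai * fps_outer ai)"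
      unfolding left_diff_distrib unit S_def fps_outer_mult fps_const_mult[symmetric] by (simp only: mult_ac)
    also have "kronecker * \<dots> = (kronecker * theta_product) * (fps_const (fps_const E) * fps_const ai * fps_outer ai)"
      unfolding Etheta[symmetric] by (simp only: mult_ac)
    also have "\<dots> = fps_const P * fps_outer R"
      unfolding H P_def R_def fps_outer_mult fps_const_mult[symmetric] by (simp only: mult_ac)
    finally show ?thesis .
  qed
  have b01: "b $ 0 = 0" "b $ 1 = 0" using A1 by (simp_all add: b_def)
  have S01: "S $ 0 = 0" "S $ 1 = 0" using b01 by (simp_all add: S_def fps_mult_nth)
  have S2: "S $ 2 = b $ 2 * y"
    using b01 by (simp add: S_def fps_mult_nth numeral_2_eq_2 ai0)
  have h0: "h $ 0 = 0" by (simp add: h_def kronecker_nth_0_0)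
  have "h $ 1 = 2 * b $ 2"
    using kronecker_theta_nth_1_0 by (simp add: h_def b_def A_def B_def)
  then have R01: "R $ 0 = 0" "R $ 1 = 2 * S $ 2"
    using h0 by (simp_all add: R_def fps_mult_nth S2 ai0 mult.assoc)
  have P0: "P $ 0 = 1" by (simp add: P_def ai0 Ey)
  \<comment> \<open>The factor 2 from \<open>kronecker_nth\<close> in each row matches
    \<open>R $ 1 = 2 * S $ 2\<close>, and n + n (n - 1) = n^2.\<close>
  have det2: "2 ^ n * det (mat n n (\<lambda>(i, j). kronecker_coeff i j)) = 2 ^ n * (S $ 2) ^ (n\<^sup>2)" for n
  proof -
    have "2 ^ n * det (mat n n (\<lambda>(i, j). kronecker_coeff i j)) =
        det (mat n n (\<lambda>(i, j). kronecker $ (2 * j + 1) $ (2 * i)))"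
      unfolding kronecker_nth using det_scale_rows_cols[of n "\<lambda>_. 2" "\<lambda>_. 1" kronecker_coeff] by simp
    also have "\<dots> = (P $ 0 * R $ 1) ^ n * (S $ 2) ^ (n * (n - 1))"
      by (rule det_odd_even_coeffs[OF F S01 R01(1)])
    also have "\<dots> = 2 ^ n * ((S $ 2) ^ n * (S $ 2) ^ (n * (n - 1)))"
      unfolding P0 R01(2) by (simp only: mult_1_left power_mult_distrib mult.assoc)
    also have "(S $ 2) ^ n * (S $ 2) ^ (n * (n - 1)) = (S $ 2) ^ (n\<^sup>2)"
      unfolding power_add[symmetric] by (intro arg_cong[where f = "(^) _"]) (cases n; simp add: power2_eq_square)
    finally show ?thesis .
  qed
  have det': "det (mat n n (\<lambda>(i, j). kronecker_coeff i j)) = (S $ 2) ^ (n\<^sup>2)" for n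
    using det2[of n] unfolding mult_cancel_left by simp
  have S2r: "S $ 2 = kronecker_coeff 0 0"
    using det'[of 1] by (simp add: det_single)
  show ?det using det'[of m] by (simp add: S2r)
  have "kronecker_coeff 0 0 * E = b $ 2"
    unfolding S2r[symmetric] S2 using Ey by (metis mult.assoc mult.commute mult_1_right)
  moreover have "b $ 2 = A $ 0 * B $ 2 - B $ 0 * A $ 2" by (simp add: b_def)
  ultimately have "2 * kronecker_coeff 0 0 * E = 2 * (A $ 0 * B $ 2 - B $ 0 * A $ 2)"
    by (simp only: mult.assoc)
  then have "2 * kronecker_coeff 0 0 * E = A $ 0 * (2 * B $ 2) - B $ 0 * (2 * A $ 2)"
    by (simp only: right_diff_distrib mult.left_commute)
  then show ?wronskian
    unfolding A_def B_def E_def fps_nth_Abs_fps fps_X_deriv_theta_moment_0[symmetric]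
      theta_moment_even_0 theta_moment_odd_0 by (simp only: mult.assoc)
qed

section \<open>The (0, 0) moment and the triangle series\<close>

lemma kronecker_coeff_0_0_nth: "kronecker_coeff 0 0 $ 0 = 0" "kronecker_coeff 0 0 $ 1 = 1"
proof -
  have "(2 * a + 1) * (2 * b + 1) \<noteq> 0" for a b :: int
  proof -
    have "odd ((2 * a + 1) * (2 * b + 1))" by simp
    then show ?thesis by (metis even_zero)
  qed
  moreover have "{z \<in> {0..} \<times> {0..}. odd_prod z = 1} = {(0, 0)}"
    by (auto simp: odd_prod_def zmult_eq_1_iff)
  ultimately show "kronecker_coeff 0 0 $ 0 = 0" "kronecker_coeff 0 0 $ 1 = 1"
    by (auto simp: kronecker_coeff_def qsum_nth odd_prod_def intro!: sum.neutral)
qed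

text \<open>k and -1 - k give the same k^2 + k, whence the factor 2; with q = t^2 the exponent n (n
  + 1) / 2 of q is n (n + 1) in t.\<close>

lemma theta_half_eq_triangle_series: "theta_half 1 = 2 * triangle_series (qpow 1)"
proof -
  let ?T = "qsum UNIV (\<lambda>n::nat. int n * int (n + 1)) (\<lambda>_. 1)"
  let ?e = "\<lambda>k::int. k\<^sup>2 + k"
  have fin: "nonneg_finite_fibres UNIV (\<lambda>n::nat. int n * int (n + 1))"
    by (rule nonneg_finite_fibres_inj[OF nonneg_finite_fibres_square_add[of 1], where f = int])
      (auto simp: power2_eq_square algebra_simps)
  have "(\<lambda>n. fps_X ^ (n * (n + 1))) sums ?T"
    using has_sum_imp_sums[OF has_sum_qsum[OF fin, of "\<lambda>_. 1"]]
    by (simp add: nat_mult_distrib nat_add_distrib del: mult_Suc_right)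
  moreover have "(qpow 1) ^ (n * (n + 1) div 2) = fps_X ^ (n * (n + 1))" for n
  proof -
    have "2 * (n * (n + 1) div 2) = n * (n + 1)" by simp
    then show ?thesis by (simp only: qpow_def flip: power_mult) simp
  qed
  ultimately have T: "triangle_series (qpow 1) = ?T"
    unfolding triangle_series_def by (simp add: sums_iff)
  have "theta_half 1 = qsum ({0..} \<union> {..<0}) ?e (\<lambda>_. 1)"
    unfolding theta_half_def by (rule arg_cong3[where f = qsum]) auto
  also have "\<dots> = qsum {0..} ?e (\<lambda>_. 1) + qsum {..<0} ?e (\<lambda>_. 1)"
    by (rule qsum_union) (use nonneg_finite_fibres_subset[OF nonneg_finite_fibres_square_add[of 1]] in auto)
  also have "qsum {0..} ?e (\<lambda>_. 1) = ?T"
    by (rule qsum_reindex[where f = nat], rule bij_betw_byWitness[where f' = int])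
      (auto simp: power2_eq_square algebra_simps)
  also have "qsum {..<0} ?e (\<lambda>_. 1) = ?T"
    by (rule qsum_reindex[where f = "\<lambda>k. nat (- 1 - k)"], rule bij_betw_byWitness[where f' = "\<lambda>n. - 1 - int n"])
      (auto simp: power2_eq_square algebra_simps)
  finally show ?thesis by (simp add: T)
qed

lemma kronecker_coeff_0_0_eq: "kronecker_coeff 0 0 = fps_X * triangle_series (qpow 1) ^ 4"
proof -
  have "16 * kronecker_coeff 0 0 = fps_X * theta_half 1 ^ 4"
    by (rule wronskian_quotient_eq_theta_half_power4[OF det_kronecker_coeff(2) kronecker_coeff_0_0_nth])
  also have "\<dots> = 16 * (fps_X * triangle_series (qpow 1) ^ 4)"
    by (simp add: theta_half_eq_triangle_series power_mult_distrib)
  finally show ?thesis unfolding mult_cancel_left by simp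
qed

section \<open>The weight as a product of determinants, and the sum over tuples\<close>

lemma prod_pairs_eq:
  fixes h :: "nat \<Rightarrow> nat \<Rightarrow> 'a::comm_monoid_mult"
  shows "(\<Prod>i=1..m. \<Prod>j=i+1..m. h i j) = (\<Prod>i<m. \<Prod>l<i. h (Suc l) (Suc i))"
proof (induction m)
  case (Suc m)
  have "(\<Prod>i=1..Suc m. \<Prod>j=i+1..Suc m. h i j) = (\<Prod>i=1..m. (\<Prod>j=i+1..m. h i j) * h i (Suc m))"
    by (simp add: prod.cl_ivl_Suc mult.commute)
  also have "\<dots> = (\<Prod>i=1..m. \<Prod>j=i+1..m. h i j) * (\<Prod>i=1..m. h i (Suc m))"
    by (rule prod.distrib)
  also have "(\<Prod>i=1..m. h i (Suc m)) = (\<Prod>l<m. h (Suc l) (Suc m))"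
    by (simp add: prod.atLeast1_atMost_eq)
  finally show ?case using Suc by simp
qed simp

text \<open>Normalisation: the factorials pulled out of the two determinants, times the m! of
  \<open>andreief\<close>, are the reciprocal of the prefactor in the theorem.\<close>

lemma prod_fact_identity:
  "2 ^ m * fact (2 * m) * fact m * (\<Prod>i<m. fact (2 * i) * fact (2 * i + 1)) =
    (\<Prod>j=1..m. (fact (2 * j))\<^sup>2 :: real)"
proof (induction m)
  case (Suc m)
  have sq: "2 * (2 * x + 2) * (2 * x + 1) * (x + 1) * F * ((2 * x + 1) * F) =
      ((2 * x + 2) * ((2 * x + 1) * F))\<^sup>2" for x F :: real
    by (simp add: power2_eq_square algebra_simps)
  have f: "(fact (2 * m + 1) :: real) = (2 * real m + 1) * fact (2 * m)"
    "(fact (2 * Suc m) :: real) = (2 * real m + 2) * ((2 * real m + 1) * fact (2 * m))"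
    "(fact (Suc m) :: real) = (real m + 1) * fact m"
    by (simp_all add: algebra_simps)
  have "2 ^ Suc m * fact (2 * Suc m) * fact (Suc m) * (\<Prod>i<Suc m. fact (2 * i) * fact (2 * i + 1)) =
      (2 ^ m * fact (2 * m) * fact m * (\<Prod>i<m. fact (2 * i) * fact (2 * i + 1))) *
      (2 * (2 * real m + 2) * (2 * real m + 1) * (real m + 1) * fact (2 * m) * fact (2 * m + 1))"
    unfolding prod.lessThan_Suc power_Suc f by (simp only: mult_ac)
  also have "2 * (2 * real m + 2) * (2 * real m + 1) * (real m + 1) * fact (2 * m) * fact (2 * m + 1) =
      (fact (2 * Suc m))\<^sup>2"
    unfolding f by (rule sq)
  also note Suc
  also have "(\<Prod>j=1..m. (fact (2 * j))\<^sup>2) * (fact (2 * Suc m))\<^sup>2 = (\<Prod>j=1..Suc m. (fact (2 * j))\<^sup>2 :: real)"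
    by simp
  finally show ?case .
qed simp

text \<open>After factorials are taken out of the columns, these are Vandermonde determinants in
  (x_j - y_j)^2 and (x_j + y_j)^2, the second with the row factors x_j + y_j.\<close>

lemma f_weight_eq_det:
  fixes z :: "nat \<Rightarrow> int \<times> int"
  assumes "\<And>j. j < m \<Longrightarrow> x (Suc j) = of_int (fst (z j)) + 1/2"
    and "\<And>j. j < m \<Longrightarrow> y (Suc j) = of_int (snd (z j)) + 1/2"
  shows "f_weight m x y = (\<Prod>i<m. fact (2 * i) * fact (2 * i + 1)) *
    (det (mat m m (\<lambda>(j, a). of_int (fst (z j) - snd (z j)) ^ (2 * a) / fact (2 * a))) *
     det (mat m m (\<lambda>(j, b). of_int (fst (z j) + snd (z j) + 1) ^ (2 * b + 1) / fact (2 * b + 1))))"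
proof -
  let ?n = "\<lambda>j. real_of_int (fst (z j) - snd (z j))"
  let ?N = "\<lambda>j. real_of_int (fst (z j) + snd (z j) + 1)"
  \<comment> \<open>The weight takes smaller minus larger index, Vandermonde the opposite; the signs
    cancel because the differences come in pairs.\<close>
  have swap: "(p - q) * (r - s) = (q - p) * (s - r)" for p q r s :: real
    by (simp add: algebra_simps)
  have cancel: "v * (n * w) = c * (p * v * (n * q * w))" if "c * (p * q) = 1" for c n p q v w :: real
  proof -
    have "c * (p * v * (n * q * w)) = (c * (p * q)) * (v * (n * w))" by (simp only: mult_ac)
    with that show ?thesis by simp
  qed
  let ?V = "\<lambda>h. \<Prod>i<m. \<Prod>l<i. (h i)\<^sup>2 - (h l)\<^sup>2 :: real"
  have xy: "x (Suc j) + y (Suc j) = ?N j" "x (Suc j) - y (Suc j) = ?n j" if "j < m" for j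
    using assms that by auto
  have "f_weight m x y = (\<Prod>j<m. x (Suc j) + y (Suc j)) * (\<Prod>i<m. \<Prod>l<i.
      ((x (Suc l) - y (Suc l))\<^sup>2 - (x (Suc i) - y (Suc i))\<^sup>2) *
      ((x (Suc l) + y (Suc l))\<^sup>2 - (x (Suc i) + y (Suc i))\<^sup>2))"
    unfolding f_weight_def prod_pairs_eq unfolding One_nat_def prod.atLeast1_atMost_eq ..
  also have "\<dots> = (\<Prod>j<m. ?N j) * (\<Prod>i<m. \<Prod>l<i. ((?n i)\<^sup>2 - (?n l)\<^sup>2) * ((?N i)\<^sup>2 - (?N l)\<^sup>2))"
  proof (rule arg_cong2[where f = "(*)"])
    show "(\<Prod>j<m. x (Suc j) + y (Suc j)) = (\<Prod>j<m. ?N j)" by (simp add: xy)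
  next
    show "(\<Prod>i<m. \<Prod>l<i. ((x (Suc l) - y (Suc l))\<^sup>2 - (x (Suc i) - y (Suc i))\<^sup>2) *
        ((x (Suc l) + y (Suc l))\<^sup>2 - (x (Suc i) + y (Suc i))\<^sup>2)) =
      (\<Prod>i<m. \<Prod>l<i. ((?n i)\<^sup>2 - (?n l)\<^sup>2) * ((?N i)\<^sup>2 - (?N l)\<^sup>2))"
    proof (rule prod.cong[OF refl], rule prod.cong[OF refl])
    fix i l assume "i \<in> {..<m}" "l \<in> {..<i}"
    then have "i < m" "l < m" by auto
    show "((x (Suc l) - y (Suc l))\<^sup>2 - (x (Suc i) - y (Suc i))\<^sup>2) *
      ((x (Suc l) + y (Suc l))\<^sup>2 - (x (Suc i) + y (Suc i))\<^sup>2) =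
      ((?n i)\<^sup>2 - (?n l)\<^sup>2) * ((?N i)\<^sup>2 - (?N l)\<^sup>2)"
      unfolding xy[OF \<open>i < m\<close>] xy[OF \<open>l < m\<close>] by (rule swap)
    qed
  qed
  also have "\<dots> = ?V ?n * ((\<Prod>j<m. ?N j) * ?V ?N)"
    by (simp only: prod.distrib mult_ac)
  finally have f: "f_weight m x y = ?V ?n * ((\<Prod>j<m. ?N j) * ?V ?N)" .
  have V: "?V h = det (mat m m (\<lambda>(i, j). ((h i)\<^sup>2) ^ j))" for h
    by (rule det_vandermonde[symmetric])
  have "(\<lambda>(j, a). ?n j ^ (2 * a) / fact (2 * a)) = (\<lambda>(j, a). 1 * (1 / fact (2 * a)) * ((?n j)\<^sup>2) ^ a)"
    by (auto simp: power_mult)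
  then have d1: "det (mat m m (\<lambda>(j, a). ?n j ^ (2 * a) / fact (2 * a))) = (\<Prod>a<m. 1 / fact (2 * a)) * ?V ?n"
    unfolding V by (simp only: det_scale_rows_cols) simp
  have "(\<lambda>(j, b). ?N j ^ (2 * b + 1) / fact (2 * b + 1)) = (\<lambda>(j, b). ?N j * (1 / fact (2 * b + 1)) * ((?N j)\<^sup>2) ^ b)"
    by (auto simp: power_mult)
  then have d2: "det (mat m m (\<lambda>(j, b). ?N j ^ (2 * b + 1) / fact (2 * b + 1))) =
      (\<Prod>j<m. ?N j) * (\<Prod>b<m. 1 / fact (2 * b + 1)) * ?V ?N"
    unfolding V by (simp only: det_scale_rows_cols)
  have c: "(\<Prod>i<m. fact (2 * i) * fact (2 * i + 1)) * ((\<Prod>a<m. 1 / fact (2 * a)) * (\<Prod>b<m. 1 / fact (2 * b + 1))) = (1::real)"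
    unfolding prod.distrib[symmetric] by (rule prod.neutral) simp
  show ?thesis
    unfolding f d1 d2 by (rule cancel[OF c])
qed

text \<open>\<open>f_weight_eq_det\<close> makes the sum an instance of \<open>andreief\<close>,
  after two tuples are reindexed as one tuple of pairs; the tuples start at 1, the matrix rows at
  0.\<close>

lemma has_sum_half_odd_tuples:
  "((\<lambda>(x, y). fps_const (f_weight m x y) * qpow (2 * (\<Sum>j=1..m. x j * y j))) has_sum
    fps_const ((\<Prod>i<m. fact (2 * i) * fact (2 * i + 1)) * fact m) * kronecker_coeff 0 0 ^ (m\<^sup>2))
    (half_odd_tuples m \<times> half_odd_tuples m)"
proof -
  let ?I = "{0..} \<times> {0..} :: (int \<times> int) set"
  let ?T = "{0..<m} \<rightarrow>\<^sub>E ?I"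
  let ?e = "\<lambda>z. \<Sum>j=0..<m. odd_prod (z j)"
  let ?C = "\<Prod>i<m. fact (2 * i) * fact (2 * i + 1) :: real"
  let ?u = "\<lambda>a (p :: int \<times> int). of_int (fst p - snd p) ^ (2 * a) / fact (2 * a) :: real"
  let ?v = "\<lambda>b (p :: int \<times> int). of_int (fst p + snd p + 1) ^ (2 * b + 1) / fact (2 * b + 1) :: real"
  let ?w = "\<lambda>z. ?C * (det (mat m m (\<lambda>(j, a). ?u a (z j))) * det (mat m m (\<lambda>(j, b). ?v b (z j))))"
  define X where "X = (\<lambda>z :: nat \<Rightarrow> int \<times> int. \<lambda>j\<in>{1..m}. real_of_int (fst (z (j - 1))) + 1/2)"
  define Y where "Y = (\<lambda>z :: nat \<Rightarrow> int \<times> int. \<lambda>j\<in>{1..m}. real_of_int (snd (z (j - 1))) + 1/2)"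
  define G where "G = (\<lambda>(x, y). \<lambda>i\<in>{0..<m}. (\<lfloor>x (Suc i) :: real\<rfloor>, \<lfloor>y (Suc i) :: real\<rfloor>))"
  have fin: "nonneg_finite_fibres ?I odd_prod"
    by (rule nonneg_finite_fibres_subset[OF nonneg_finite_fibres_same_sign]) (auto simp: same_sign_def)
  have finT: "nonneg_finite_fibres ?T ?e" by (rule nonneg_finite_fibres_PiE[OF _ fin]) simp
  have half: "r \<in> half_odds \<longleftrightarrow> (\<exists>k\<ge>0. r = of_int k + 1/2)" for r
  proof
    assume "r \<in> half_odds"
    then obtain n where "r = 1/2 + real n" by (auto simp: half_odds_def)
    then show "\<exists>k\<ge>0. r = of_int k + 1/2" by (intro exI[of _ "int n"]) auto
  next
    assume "\<exists>k\<ge>0. r = of_int k + 1/2"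
    then obtain k :: int where "k \<ge> 0" "r = of_int k + 1/2" by auto
    then show "r \<in> half_odds" unfolding half_odds_def by (intro CollectI exI[of _ "nat k"]) auto
  qed
  have floor_half: "\<lfloor>real_of_int k + 1/2\<rfloor> = k" for k by linarith
  have bij: "bij_betw (\<lambda>z. (X z, Y z)) ?T (half_odd_tuples m \<times> half_odd_tuples m)"
  proof (rule bij_betw_byWitness[where f' = G])
    show "\<forall>z\<in>?T. G (X z, Y z) = z"
      by (auto simp: G_def X_def Y_def floor_half fun_eq_iff PiE_def extensional_def)
    show "\<forall>p\<in>half_odd_tuples m \<times> half_odd_tuples m. (X (G p), Y (G p)) = p"
    proof safe
      fix x y assume xy: "x \<in> half_odd_tuples m" "y \<in> half_odd_tuples m"
      have *: "of_int \<lfloor>t j\<rfloor> + 1/2 = t j" if "t \<in> half_odd_tuples m" "j \<in> {1..m}" for t j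
      proof -
        have "t j \<in> half_odds" using that by (auto simp: half_odd_tuples_def)
        then show ?thesis using half floor_half by auto
      qed
      have **: "t j = undefined" if "t \<in> half_odd_tuples m" "j \<notin> {1..m}" for t j
        using that unfolding half_odd_tuples_def by (rule PiE_arb)
      show "X (G (x, y)) = x"
        using *[OF xy(1)] **[OF xy(1)] by (auto simp: X_def G_def fun_eq_iff restrict_def)
      show "Y (G (x, y)) = y"
        using *[OF xy(2)] **[OF xy(2)] by (auto simp: Y_def G_def fun_eq_iff restrict_def)
    qed
    have "fst (z (j - 1)) \<ge> 0" "snd (z (j - 1)) \<ge> 0" if "z \<in> ?T" "j \<in> {1..m}" for z j
    proof -
      have "z (j - 1) \<in> ?I" by (rule PiE_mem[OF that(1)]) (use that(2) in auto)
      then show "fst (z (j - 1)) \<ge> 0" "snd (z (j - 1)) \<ge> 0" by (auto simp: mem_Times_iff)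
    qed
    then show "(\<lambda>z. (X z, Y z)) ` ?T \<subseteq> half_odd_tuples m \<times> half_odd_tuples m"
      by (auto simp: half_odd_tuples_def X_def Y_def half)
    show "G ` (half_odd_tuples m \<times> half_odd_tuples m) \<subseteq> ?T"
    proof (rule image_subsetI)
      fix p assume "p \<in> half_odd_tuples m \<times> half_odd_tuples m"
      then obtain x y where p: "p = (x, y)" "x \<in> half_odd_tuples m" "y \<in> half_odd_tuples m" by auto
      have "\<lfloor>t (Suc i)\<rfloor> \<ge> 0" if "t \<in> half_odd_tuples m" "i < m" for t i
      proof -
        have "t (Suc i) \<in> half_odds" using that by (auto simp: half_odd_tuples_def)
        then show ?thesis using half by auto
      qed
      with p show "G p \<in> ?T" by (auto simp: G_def)
    qed
  qed
  have terms: "fps_const (f_weight m (X z) (Y z)) * qpow (2 * (\<Sum>j=1..m. X z j * Y z j)) =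
      fps_const (?w z) * fps_X ^ nat (?e z)" for z
  proof -
    have "f_weight m (X z) (Y z) = ?w z"
      by (rule f_weight_eq_det) (auto simp: X_def Y_def)
    \<comment> \<open>\<open>qpow r\<close> is t^(2r), so the exponent in t is 4 times the sum of
      the x_j y_j, which is the sum of \<open>odd_prod\<close>.\<close>
    moreover have "2 * (2 * (\<Sum>j=1..m. X z j * Y z j)) = of_int (?e z)"
    proof -
      have "2 * (2 * (\<Sum>j=1..m. X z j * Y z j)) = (\<Sum>j<m. 4 * (X z (Suc j) * Y z (Suc j)))"
        by (simp add: sum.atLeast1_atMost_eq sum_distrib_left)
      also have "\<dots> = (\<Sum>j<m. of_int (odd_prod (z j)))"
        by (rule sum.cong) (auto simp: X_def Y_def odd_prod_def case_prod_unfold algebra_simps)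
      finally show ?thesis by (simp add: lessThan_atLeast0)
    qed
    ultimately show ?thesis unfolding qpow_def by (simp only: floor_of_int)
  qed
  have "qsum ?T ?e ?w = fps_const ?C * (fact m * det (mat m m (\<lambda>(a, b). qsum ?I odd_prod (\<lambda>i. ?u a i * ?v b i))))"
    using andreief[OF fin, of m ?u ?v] by (simp only: qsum_cmult)
  also have "(\<lambda>(a, b). qsum ?I odd_prod (\<lambda>i. ?u a i * ?v b i)) = (\<lambda>(i, j). kronecker_coeff i j)"
    by (simp add: kronecker_coeff_def case_prod_unfold)
  also have "fps_const ?C * (fact m * det (mat m m (\<lambda>(i, j). kronecker_coeff i j))) =
      fps_const (?C * fact m) * kronecker_coeff 0 0 ^ (m\<^sup>2)"
  proof -
    have "(fact m :: real fps) = fps_const (fact m)"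
      by (metis fps_of_nat of_nat_fact)
    then show ?thesis by (simp add: det_kronecker_coeff(1) mult.assoc flip: fps_const_mult)
  qed
  finally have "((\<lambda>z. fps_const (?w z) * fps_X ^ nat (?e z)) has_sum
      fps_const (?C * fact m) * kronecker_coeff 0 0 ^ (m\<^sup>2)) ?T"
    using has_sum_qsum[OF finT, of ?w] by simp
  then have "((\<lambda>z. (\<lambda>(x, y). fps_const (f_weight m x y) * qpow (2 * (\<Sum>j=1..m. x j * y j))) (X z, Y z))
      has_sum fps_const (?C * fact m) * kronecker_coeff 0 0 ^ (m\<^sup>2)) ?T"
    by (simp only: terms prod.case)
  then show ?thesis
    by (rule has_sum_reindex_bij_betw[OF bij, THEN iffD1])
qed

theorem theorem1p2:
  fixes m :: nat
  assumes "m \<ge> 1"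
  shows "qpow (real (m\<^sup>2) / 2) * triangle_series (qpow 1) ^ (4 * m\<^sup>2) =
    fps_const (2 ^ m * fact (2 * m) / (\<Prod>j=1..m. (fact (2 * j))\<^sup>2)) *
    (\<Sum>\<^sub>\<infinity>(x, y) \<in> half_odd_tuples m \<times> half_odd_tuples m.
       fps_const (f_weight m x y) * qpow (2 * (\<Sum>j=1..m. x j * y j)))"
proof -
  let ?C = "\<Prod>i<m. fact (2 * i) * fact (2 * i + 1) :: real"
  have "(\<Prod>j=1..m. (fact (2 * j))\<^sup>2) \<noteq> (0 :: real)" by simp
  then have "2 ^ m * fact (2 * m) / (\<Prod>j=1..m. (fact (2 * j))\<^sup>2) * (?C * fact m) = 1"
    unfolding prod_fact_identity[of m, symmetric] by (simp add: field_simps)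
  then have "fps_const (2 ^ m * fact (2 * m) / (\<Prod>j=1..m. (fact (2 * j))\<^sup>2)) *
      (fps_const (?C * fact m) * kronecker_coeff 0 0 ^ (m\<^sup>2)) = kronecker_coeff 0 0 ^ (m\<^sup>2)"
    unfolding mult.assoc[symmetric] fps_const_mult by simp
  also have "\<dots> = qpow (real (m\<^sup>2) / 2) * triangle_series (qpow 1) ^ (4 * m\<^sup>2)"
    unfolding kronecker_coeff_0_0_eq power_mult_distrib power_mult qpow_half_of_nat ..
  finally show ?thesis
    unfolding infsumI[OF has_sum_half_odd_tuples] by simp
qed

end
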